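(* Let $p\ge 2$ be a real number, let $\mathcal{H}$ be a Hilbert space, and let $F:(0,\infty)\to\mathcal{B}(\mathcal{H})^+$ be a weakly measurable mapping such that $$\int_{0}^{\infty}F(x)^p\,dx\in\mathcal{B}(\mathcal{H}).$$ Then for every unit vector $\eta\in\mathcal{H}$, $$\begin{aligned} \int_{0}^{\infty} \left\langle\frac{1}{x}\int_{0}^{x}F(t)\,dt\ \eta,\eta\right\rangle^p dx &\le \left(\frac{p}{p-1}\right)^p\int_{0}^{\infty}\left\langle F(x)^p\eta,\eta\right\rangle dx\\ &\quad-\left(\frac{p}{p-1}\right)^{p-2}\left\langle \int_{0}^{\infty}\frac{1}{x}\int_{0}^{x} x^{\frac{1}{p}}t^{-\frac{1}{p}}\left|x^{-\frac{1}{p}}t^{\frac{1}{p}}F(t)-\frac{p-1}{p}\left\langle\frac{1}{x}\int_{0}^{x}F(r)\,dr\ \eta,\eta\right\rangle\right|^p dt\,dx\ \eta,\eta\right\rangle . \end{aligned}$$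
   Context: $\mathcal{B}(\mathcal{H})$ is the $C^*$-algebra of all bounded linear operators on the Hilbert space $\mathcal{H}$, with identity $I$, and $\mathcal{B}(\mathcal{H})^+$ is the set of positive (i.e. positive semidefinite) operators in it. A mapping $F$ into $\mathcal{B}(\mathcal{H})$ is weakly measurable if $t\mapsto\langle F(t)\xi,\zeta\rangle$ is measurable for all $\xi,\zeta\in\mathcal{H}$. Integrals of operator-valued mappings are understood in the weak sense: $\langle \int F(t)\,dt\ \xi,\zeta\rangle=\int\langle F(t)\xi,\zeta\rangle\,dt$; the condition $\int_0^\infty F(x)^p\,dx\in\mathcal{B}(\mathcal{H})$ means that this weak integral exists and is a bounded operator. For a self-adjoint operator $T$ and a real scalar $c$, $T-c$ means $T-cI$, $|T|=(T^2)^{1/2}$, and $p$-th powers of positive operators are defined by the continuous functional calculus.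
   Formalization: In a non-separable space the remainder's double weak integral may not exist; its existence is claimed only when its integrand is weakly measurable in t (automatic for separable spaces), and a weak integral that does not exist counts as 0 in the inequality. *)

theory Defs
  imports "HOL-Analysis.Analysis"
begin

text \<open>
  Complex Hilbert spaces; the inner product is linear in its first argument.
\<close>

class complex_hilbert_space = banach +
  fixes scaleC :: "complex \<Rightarrow> 'a \<Rightarrow> 'a"
    and cinner :: "'a \<Rightarrow> 'a \<Rightarrow> complex"
  assumes scaleC_add_right: "scaleC a (x + y) = scaleC a x + scaleC a y"
    and scaleC_add_left: "scaleC (a + b) x = scaleC a x + scaleC b x"
    and scaleC_scaleC: "scaleC a (scaleC b x) = scaleC (a * b) x"
    and scaleC_of_real: "scaleC (complex_of_real r) x = scaleR r x"
    and cinner_commute: "cinner x y = cnj (cinner y x)"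
    and cinner_add_left: "cinner (x + y) z = cinner x z + cinner y z"
    and cinner_scaleC_left: "cinner (scaleC a x) y = a * cinner x y"
    and cinner_self: "cinner x x = complex_of_real ((norm x)\<^sup>2)"

instantiation complex :: complex_hilbert_space
begin

definition scaleC_complex :: "complex \<Rightarrow> complex \<Rightarrow> complex"
  where "scaleC_complex a x = a * x"

definition cinner_complex :: "complex \<Rightarrow> complex \<Rightarrow> complex"
  where "cinner_complex x y = x * cnj y"

instance
  by standard
    (simp_all add: scaleC_complex_def cinner_complex_def algebra_simps scaleR_conv_of_real
      complex_norm_square del: of_real_power)

end

text \<open>
  The library type of bounded linear operators consists of the real-linear ones; the algebra
  of bounded operators on a complex Hilbert space is the subset of the complex-linear ones.
\<close>

definition bounded_ops :: "('h::complex_hilbert_space \<Rightarrow>\<^sub>L 'h) set"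
  where "bounded_ops = {T :: 'h \<Rightarrow>\<^sub>L 'h. \<forall>c x. T (scaleC c x) = scaleC c (T x)}"

definition positive_ops :: "('h::complex_hilbert_space \<Rightarrow>\<^sub>L 'h) set"
  where "positive_ops = {T \<in> bounded_ops. \<forall>x. cinner (T x) x \<in> \<real>\<^sub>\<ge>\<^sub>0}"

definition spectrum :: "('h::complex_hilbert_space \<Rightarrow>\<^sub>L 'h) \<Rightarrow> complex set"
  where "spectrum T =
    {z. \<not> (\<exists>S :: 'h \<Rightarrow>\<^sub>L 'h. S \<in> bounded_ops \<and> (\<forall>x. S (T x - scaleC z x) = x \<and> T (S x) - scaleC z (S x) = x))}"

definition poly_op :: "real poly \<Rightarrow> ('h::complex_hilbert_space \<Rightarrow>\<^sub>L 'h) \<Rightarrow> 'h \<Rightarrow>\<^sub>L 'h"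
  where "poly_op q T = (\<Sum>i\<le>degree q. coeff q i *\<^sub>R ((\<lambda>S. T o\<^sub>L S) ^^ i) id_blinfun)"

text \<open>
  Continuous functional calculus of a self-adjoint operator \<open>T\<close> (whose spectrum is real) for a
  real function \<open>f\<close> continuous on the spectrum: \<open>f(T)\<close> is the limit in operator norm of
  \<open>q\<^sub>n(T)\<close>, where \<open>q\<^sub>n\<close> are real polynomials converging to \<open>f\<close> uniformly on the spectrum.
\<close>

definition cfc :: "(real \<Rightarrow> real) \<Rightarrow> ('h::complex_hilbert_space \<Rightarrow>\<^sub>L 'h) \<Rightarrow> 'h \<Rightarrow>\<^sub>L 'h"
  where "cfc f T = (THE S. \<exists>q :: nat \<Rightarrow> real poly.
    uniform_limit {r. complex_of_real r \<in> spectrum T} (\<lambda>n. poly (q n)) f sequentially \<and>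
    (\<lambda>n. poly_op (q n) T) \<longlonglongrightarrow> S)"

definition op_powr :: "('h::complex_hilbert_space \<Rightarrow>\<^sub>L 'h) \<Rightarrow> real \<Rightarrow> 'h \<Rightarrow>\<^sub>L 'h"
  where "op_powr T a = cfc (\<lambda>r. r powr a) T"

definition op_abs :: "('h::complex_hilbert_space \<Rightarrow>\<^sub>L 'h) \<Rightarrow> 'h \<Rightarrow>\<^sub>L 'h"
  where "op_abs T = op_powr (T o\<^sub>L T) (1 / 2)"

definition weakly_measurable :: "real set \<Rightarrow> (real \<Rightarrow> 'h::complex_hilbert_space \<Rightarrow>\<^sub>L 'h) \<Rightarrow> bool"
  where "weakly_measurable S G \<longleftrightarrow>
    (\<forall>\<xi> \<zeta>. (\<lambda>t. cinner (G t \<xi>) \<zeta>) \<in> borel_measurable (lebesgue_on S))"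

definition has_weak_integral ::
    "(real \<Rightarrow> 'h::complex_hilbert_space \<Rightarrow>\<^sub>L 'h) \<Rightarrow> ('h \<Rightarrow>\<^sub>L 'h) \<Rightarrow> real set \<Rightarrow> bool"
  where "has_weak_integral G A S \<longleftrightarrow> A \<in> bounded_ops \<and>
    (\<forall>\<xi> \<zeta>. has_bochner_integral (lebesgue_on S) (\<lambda>t. cinner (G t \<xi>) \<zeta>) (cinner (A \<xi>) \<zeta>))"

definition weakly_integrable :: "real set \<Rightarrow> (real \<Rightarrow> 'h::complex_hilbert_space \<Rightarrow>\<^sub>L 'h) \<Rightarrow> bool"
  where "weakly_integrable S G \<longleftrightarrow> (\<exists>A. has_weak_integral G A S)"

text \<open>As for the Bochner integral, the value is \<open>0\<close> when the integral does not exist.\<close>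

definition weak_integral ::
    "real set \<Rightarrow> (real \<Rightarrow> 'h::complex_hilbert_space \<Rightarrow>\<^sub>L 'h) \<Rightarrow> 'h \<Rightarrow>\<^sub>L 'h"
  where "weak_integral S G =
    (if weakly_integrable S G then THE A. has_weak_integral G A S else 0)"

text \<open>For self-adjoint \<open>T\<close> the inner product below is real.\<close>

definition expect :: "('h::complex_hilbert_space \<Rightarrow>\<^sub>L 'h) \<Rightarrow> 'h \<Rightarrow> real"
  where "expect T \<eta> = Re (cinner (T \<eta>) \<eta>)"

definition mean_op :: "(real \<Rightarrow> 'h::complex_hilbert_space \<Rightarrow>\<^sub>L 'h) \<Rightarrow> real \<Rightarrow> 'h \<Rightarrow>\<^sub>L 'h"
  where "mean_op G x = (1 / x) *\<^sub>R weak_integral {0<..<x} G"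

definition remainder_integrand ::
    "real \<Rightarrow> (real \<Rightarrow> 'h::complex_hilbert_space \<Rightarrow>\<^sub>L 'h) \<Rightarrow> 'h \<Rightarrow> real \<Rightarrow> real \<Rightarrow> 'h \<Rightarrow>\<^sub>L 'h"
  where "remainder_integrand p F \<eta> x t =
    (x powr (1 / p) * t powr (- (1 / p))) *\<^sub>R
      op_powr (op_abs ((x powr (- (1 / p)) * t powr (1 / p)) *\<^sub>R F t
                       - ((p - 1) / p * expect (mean_op F x) \<eta>) *\<^sub>R id_blinfun)) p"

end

theory Submission
  imports Defs "HOL-Computational_Algebra.Fundamental_Theorem_Algebra"
begin

text \<open>
  For \<open>p \<ge> 2\<close> the function \<open>r \<mapsto> r\<^sup>p\<close> is superquadratic:
  \<open>c\<^sup>p + p c\<^sup>p\<^sup>-\<^sup>1 (a - c) + \<bar>a - c\<bar>\<^sup>p \<le> a\<^sup>p\<close> for \<open>a, c \<ge> 0\<close>. By monotonicity of the functional calculus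
  this holds with \<open>a\<close> replaced by the operator \<open>x\<^sup>-\<^sup>1\<^sup>/\<^sup>p t\<^sup>1\<^sup>/\<^sup>p F(t)\<close> and with \<open>c = c(x)\<close> equal to \<open>(p - 1) / p\<close>
  times the expectation of the mean of \<open>F\<close> over \<open>(0, x)\<close>. Multiplying by \<open>x\<^sup>1\<^sup>/\<^sup>p t\<^sup>-\<^sup>1\<^sup>/\<^sup>p\<close>, taking
  expectations at \<open>\<eta>\<close> and averaging over \<open>t \<in> (0, x)\<close>, the first two terms collapse to
  \<open>p / (p - 1) c(x)\<^sup>p\<close>; integrating over \<open>x\<close> and exchanging the order of integration on the right gives the
  inequality, even with the constant \<open>(p / (p - 1))\<^sup>p\<^sup>-\<^sup>1 \<ge> (p / (p - 1))\<^sup>p\<^sup>-\<^sup>2\<close> in front of the remainder.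
  Where a weak integral fails to exist its value is \<open>0\<close>, and the estimate without remainder suffices.
\<close>

text \<open>The functional calculus rests on one estimate: the norm of P(T), for a real polynomial P
  and self-adjoint T, is at most the supremum of |P| over the real spectrum. The source of this is
  the bottom m of the numerical range of P(T): there P(T) - m is not bounded below, so a
  factorisation of P - m over the complex numbers must contain a root lying in the spectrum.

  The parameter c(x) is the maximiser over c of p c^(p-1) m - (p-1) q c^p, where m is the
  expectation of the mean of F over (0, x) and q = p/(p-1) is the average over (0, x) of the weight
  x^(1/p) t^(-1/p). The maximum is q c(x)^p. Exchanging integrals contributes the same factor q on
  the right, and m = q c accounts for the power q^p.

  The remainder is measurable only in t, for each fixed x. Measurability in x of its average
  therefore comes from continuity in x, by dominated convergence, and this is why the calculus has
  to depend continuously on the scalars s and c in |s A - c|^p. Weak integrals of positive families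
  are built from their expectations by polarization and Riesz representation.\<close>

lemma cinner_add_right: "cinner x (y + z) = cinner x y + cinner (x::'h::complex_hilbert_space) z"
  using cinner_commute[of x] cinner_add_left[of y z x] by (metis complex_cnj_add)

lemma cinner_scaleC_right: "cinner x (scaleC a y) = cnj a * cinner (x::'h::complex_hilbert_space) y"
  using cinner_commute[of x] cinner_scaleC_left[of a y x] by (metis complex_cnj_mult)

lemma cinner_scaleR_left: "cinner (r *\<^sub>R x) y = of_real r * cinner (x::'h::complex_hilbert_space) y"
  by (metis cinner_scaleC_left scaleC_of_real)

lemma cinner_scaleR_right: "cinner x (r *\<^sub>R y) = of_real r * cinner (x::'h::complex_hilbert_space) y"
  by (metis cinner_scaleC_right scaleC_of_real complex_cnj_complex_of_real)

lemma cinner_zero_left [simp]: "cinner 0 (y::'h::complex_hilbert_space) = 0"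
  using cinner_scaleR_left[of 0 0 y] by simp

lemma cinner_zero_right [simp]: "cinner (y::'h::complex_hilbert_space) 0 = 0"
  using cinner_scaleR_right[of y 0 0] by simp

lemma cinner_minus_left: "cinner (- x) y = - cinner (x::'h::complex_hilbert_space) y"
  using cinner_scaleR_left[of "-1" x y] by simp

lemma cinner_minus_right: "cinner x (- y) = - cinner (x::'h::complex_hilbert_space) y"
  using cinner_scaleR_right[of x "-1" y] by simp

lemma cinner_diff_left: "cinner (x - y) z = cinner x z - cinner (y::'h::complex_hilbert_space) z"
  by (metis cinner_add_left cinner_minus_left uminus_add_conv_diff add.commute)

lemma cinner_diff_right: "cinner x (y - z) = cinner x y - cinner (x::'h::complex_hilbert_space) z"
  by (metis cinner_add_right cinner_minus_right uminus_add_conv_diff add.commute)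

lemmas cinner_simps = cinner_add_left cinner_add_right cinner_diff_left cinner_diff_right
  cinner_scaleC_left cinner_scaleC_right cinner_scaleR_left cinner_scaleR_right
  cinner_minus_left cinner_minus_right

lemma Re_cinner_self: "Re (cinner x x) = (norm (x::'h::complex_hilbert_space))\<^sup>2"
  by (simp only: cinner_self Re_complex_of_real)

lemma Re_cinner_commute: "Re (cinner y x) = Re (cinner x (y::'h::complex_hilbert_space))"
  by (metis cinner_commute complex_cnj(1) cnj.simps(1))

lemma norm_scaleC: "norm (scaleC a (x::'h::complex_hilbert_space)) = cmod a * norm x"
proof -
  have "complex_of_real ((norm (scaleC a x))\<^sup>2) = a * cnj a * cinner x x"
    by (simp only: cinner_self[symmetric] cinner_simps mult_ac)
  also have "\<dots> = complex_of_real ((cmod a)\<^sup>2 * (norm x)\<^sup>2)"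
    by (simp only: cinner_self complex_norm_square of_real_mult)
  finally have "(norm (scaleC a x))\<^sup>2 = (cmod a * norm x)\<^sup>2"
    by (simp only: of_real_eq_iff power_mult_distrib)
  thus ?thesis by (simp add: power2_eq_iff_nonneg)
qed

lemma scaleC_zero_left [simp]: "scaleC 0 (x::'h::complex_hilbert_space) = 0"
  using scaleC_of_real[of 0 x] by simp

lemma scaleC_zero_right [simp]: "scaleC a (0::'h::complex_hilbert_space) = 0"
  using norm_scaleC[of a 0] by simp

lemma scaleC_one [simp]: "scaleC 1 (x::'h::complex_hilbert_space) = x"
  using scaleC_of_real[of 1 x] by simp

lemma scaleC_minus_left: "scaleC (- a) x = - scaleC a (x::'h::complex_hilbert_space)"
  using scaleC_add_left[of a "-a" x] by (simp add: minus_unique)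

lemma scaleC_minus_right: "scaleC a (- x) = - scaleC a (x::'h::complex_hilbert_space)"
  using scaleC_add_right[of a x "-x"] by (simp add: minus_unique)

lemma scaleC_diff_right: "scaleC a (x - y) = scaleC a x - scaleC a (y::'h::complex_hilbert_space)"
  using scaleC_add_right[of a x "-y"] by (simp add: scaleC_minus_right)

lemma scaleC_scaleR: "scaleC a (r *\<^sub>R x) = r *\<^sub>R scaleC a (x::'h::complex_hilbert_space)"
  by (metis scaleC_of_real scaleC_scaleC mult.commute)

lemma norm_diff_square:
  "(norm (x - y))\<^sup>2 = (norm x)\<^sup>2 - 2 * Re (cinner x y) + (norm (y::'h::complex_hilbert_space))\<^sup>2"
proof -
  have "(norm (x - y))\<^sup>2 = Re (cinner (x - y) (x - y))" by (simp only: Re_cinner_self)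
  also have "\<dots> = Re (cinner x x) - Re (cinner x y) - Re (cinner y x) + Re (cinner y y)"
    by (simp add: cinner_simps)
  also have "Re (cinner y x) = Re (cinner x y)" by (rule Re_cinner_commute)
  finally show ?thesis by (simp only: Re_cinner_self)
qed

lemma norm_add_square:
  "(norm (x + y))\<^sup>2 = (norm x)\<^sup>2 + 2 * Re (cinner x y) + (norm (y::'h::complex_hilbert_space))\<^sup>2"
  using norm_diff_square[of x "- y"] by (simp add: cinner_simps)

lemma cauchy_schwarz: "cmod (cinner x y) \<le> norm x * norm (y::'h::complex_hilbert_space)"
proof (cases "y = 0")
  case False
  let ?c = "cinner x y"
  \<comment> \<open>The vector is (norm y)^2 times the component of x orthogonal to y, which keeps
    the computation free of division.\<close>
  have "0 \<le> (norm ((norm y)\<^sup>2 *\<^sub>R x - scaleC ?c y))\<^sup>2" by simp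
  also have "\<dots> = (norm y)^4 * (norm x)\<^sup>2 - (norm y)\<^sup>2 * (cmod ?c)\<^sup>2"
    unfolding norm_diff_square norm_scaleC
    by (simp add: cinner_simps power_mult_distrib complex_mult_cnj cmod_power2 mult.commute)
       (simp add: power2_eq_square algebra_simps power4_eq_xxxx)
  finally have "(norm y)\<^sup>2 * (cmod ?c)\<^sup>2 \<le> (norm y)\<^sup>2 * (norm x * norm y)\<^sup>2"
    by (simp add: power2_eq_square algebra_simps power4_eq_xxxx)
  hence "(cmod ?c)\<^sup>2 \<le> (norm x * norm y)\<^sup>2" using False by simp
  thus ?thesis by (rule power2_le_imp_le) simp
qed simp

lemma Re_cinner_le: "\<bar>Re (cinner x y)\<bar> \<le> norm x * norm (y::'h::complex_hilbert_space)"
  using cauchy_schwarz[of x y] abs_Re_le_cmod[of "cinner x y"] by linarith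

text \<open>Over the reals the conjugate-linear second slot is linear, so the limit rules for
  bounded bilinear maps apply.\<close>

lemma bounded_bilinear_cinner: "bounded_bilinear (cinner :: 'h::complex_hilbert_space \<Rightarrow> 'h \<Rightarrow> complex)"
proof (unfold_locales, goal_cases)
  case 5
  show ?case by (intro exI[of _ 1]) (simp add: cauchy_schwarz)
qed (simp_all add: cinner_simps scaleR_conv_of_real)

lemmas tendsto_cinner = bounded_bilinear.tendsto[OF bounded_bilinear_cinner]

lemma cinner_ext:
  assumes "\<And>z. cinner x z = cinner y (z::'h::complex_hilbert_space)"
  shows "x = y"
proof -
  have "(norm (x - y))\<^sup>2 = Re (cinner (x - y) (x - y))" by (simp only: Re_cinner_self)
  also have "\<dots> = 0" using assms by (simp add: cinner_diff_left)
  finally show ?thesis by simp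
qed

subsection \<open>The Riesz representation theorem\<close>

text \<open>The representing vector minimises \<open>\<parallel>v\<parallel>\<^sup>2 - 2 f v\<close>; minimising sequences are Cauchy by the
  parallelogram law.\<close>

lemma riesz_real:
  fixes f :: "'h::complex_hilbert_space \<Rightarrow> real"
  assumes "bounded_linear f"
  shows "\<exists>u. \<forall>v. f v = Re (cinner v u)"
proof -
  interpret f: bounded_linear f by fact
  obtain K where K: "\<And>v. \<bar>f v\<bar> \<le> norm v * K" using f.bounded by auto
  define Q where "Q v = (norm v)\<^sup>2 - 2 * f v" for v
  have lb: "- K\<^sup>2 \<le> Q v" for v
  proof -
    have "0 \<le> (norm v - K)\<^sup>2" by simp
    thus ?thesis using K[of v] unfolding Q_def power2_diff by (simp add: abs_le_iff)
  qed
  define m where "m = Inf (range Q)"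
  have bdd: "bdd_below (range Q)" using lb by (intro bdd_belowI[of _ "- K\<^sup>2"]) blast
  have m_le: "m \<le> Q v" for v unfolding m_def by (rule cInf_lower[OF _ bdd]) simp
  have "\<exists>v. Q v < m + e" if "e > 0" for e
    using cInf_lessD[of "range Q" "m + e"] that unfolding m_def by auto
  hence "\<forall>n. \<exists>v. Q v < m + 1 / Suc n" by simp
  then obtain s where s: "\<And>n. Q (s n) < m + 1 / Suc n" by metis
  have para: "(norm (v - w))\<^sup>2 \<le> 2 * (Q v + Q w - 2 * m)" for v w
  proof -
    have "m \<le> Q ((1/2) *\<^sub>R (v + w))" by (rule m_le)
    also have "\<dots> = (norm (v + w))\<^sup>2 / 4 - f v - f w"
      unfolding Q_def by (simp add: f.scaleR f.add power_divide) (simp add: field_simps)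
    finally have "m + f v + f w \<le> (norm (v + w))\<^sup>2 / 4" by simp
    thus ?thesis unfolding Q_def using norm_add_square[of v w] norm_diff_square[of v w] by simp
  qed
  have "Cauchy s"
  proof (rule metric_CauchyI)
    fix e :: real assume e: "e > 0"
    obtain N :: nat where N: "4 / e\<^sup>2 < real N" using reals_Archimedean2 by blast
    have "dist (s i) (s j) < e" if "i \<ge> N" "j \<ge> N" for i j
    proof -
      have b: "1 / Suc k < e\<^sup>2 / 4" if "k \<ge> N" for k
      proof -
        have "4 / e\<^sup>2 < real (Suc k)" using N that by simp
        thus ?thesis using e by (simp add: field_simps)
      qed
      have "(norm (s i - s j))\<^sup>2 \<le> 2 * (Q (s i) + Q (s j) - 2 * m)" by (rule para)
      also have "\<dots> < 2 * (e\<^sup>2 / 4 + e\<^sup>2 / 4)" using s[of i] s[of j] b[OF that(1)] b[OF that(2)] by simp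
      finally have "(norm (s i - s j))\<^sup>2 < e\<^sup>2" by simp
      thus ?thesis using e by (simp add: dist_norm power2_less_imp_less)
    qed
    thus "\<exists>M. \<forall>i\<ge>M. \<forall>j\<ge>M. dist (s i) (s j) < e" by blast
  qed
  then obtain u where u: "s \<longlonglongrightarrow> u" using Cauchy_convergent convergent_def by blast
  have "(\<lambda>n. Q (s n)) \<longlonglongrightarrow> Q u" unfolding Q_def using u by (intro tendsto_intros f.tendsto)
  moreover have "(\<lambda>n. m + 1 / real (Suc n)) \<longlonglongrightarrow> m + 0" by (intro tendsto_intros LIMSEQ_Suc[OF lim_1_over_n])
  ultimately have "Q u \<le> m" using s by (intro LIMSEQ_le[of "\<lambda>n. Q (s n)" _ "\<lambda>n. m + 1 / real (Suc n)"]) (auto intro: less_imp_le)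
  hence min: "Q u \<le> Q v" for v using m_le order_trans by blast
  \<comment> \<open>First variation of \<open>Q\<close> at its minimiser. A one-sided inequality
    suffices, because it is used at \<open>v\<close> and at \<open>- v\<close>.\<close>
  have ge: "0 \<le> Re (cinner v u) - f v" for v
  proof (rule ccontr)
    assume "\<not> ?thesis"
    hence neg: "Re (cinner v u) - f v < 0" by simp
    define d where "d = - (Re (cinner v u) - f v)"
    \<comment> \<open>Small enough that the quadratic term of \<open>Q (u + t *\<^sub>R v)\<close>
      cannot outweigh the linear gain \<open>2 * t * d\<close>; the \<open>+ 1\<close> covers
      \<open>v = 0\<close>.\<close>
    define t where "t = d / ((norm v)\<^sup>2 + 1)"
    have d: "d > 0" using neg d_def by simp
    have t: "t > 0" unfolding t_def using d by (simp add: add_nonneg_pos)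
    have "Q u \<le> Q (u + t *\<^sub>R v)" by (rule min)
    also have "\<dots> = Q u - 2 * t * d + t\<^sup>2 * (norm v)\<^sup>2"
      unfolding Q_def norm_add_square d_def
      by (simp add: f.add f.scaleR cinner_simps power_mult_distrib Re_cinner_commute[of u v] algebra_simps)
    finally have "t * (2 * d) \<le> t * (t * (norm v)\<^sup>2)" by (simp add: power2_eq_square algebra_simps)
    hence "2 * d \<le> t * (norm v)\<^sup>2" using t by simp
    also have "\<dots> \<le> t * ((norm v)\<^sup>2 + 1)" using t by simp
    also have "\<dots> = d" unfolding t_def using zero_le_power2[of "norm v"] by (simp add: add_nonneg_eq_0_iff)
    finally show False using d by simp
  qed
  have "f v = Re (cinner v u)" for v using ge[of v] ge[of "- v"] by (simp add: linear_neg[OF f.linear] cinner_simps)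
  thus ?thesis by blast
qed

text \<open>A complex-linear functional is determined by its real part: the vector representing Re f
  also gives Im f, by evaluation at \<i> v.\<close>

lemma riesz:
  fixes f :: "'h::complex_hilbert_space \<Rightarrow> complex"
  assumes f: "bounded_linear f" and c: "\<And>c v. f (scaleC c v) = c * f v"
  shows "\<exists>u. \<forall>v. f v = cinner v u"
proof -
  have "bounded_linear (\<lambda>v. Re (f v))" using f bounded_linear_Re bounded_linear_compose by blast
  then obtain u where u: "\<And>v. Re (f v) = Re (cinner v u)" using riesz_real by blast
  have "Im (f v) = Im (cinner v u)" for v
    using u[of "scaleC \<i> v"] by (simp add: c cinner_simps)
  thus ?thesis using u complex_eqI by blast
qed

subsection \<open>Operators and quadratic forms\<close>

lemma bounded_ops_scaleC: "T \<in> bounded_ops \<Longrightarrow> blinfun_apply T (scaleC c x) = scaleC c (T x)"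
  by (simp add: bounded_ops_def)

definition self_adjoint :: "('h::complex_hilbert_space \<Rightarrow>\<^sub>L 'h) \<Rightarrow> bool"
  where "self_adjoint T \<longleftrightarrow> T \<in> bounded_ops \<and> (\<forall>x y. cinner (T x) y = cinner x (T y))"

text \<open>The order relation a I \<le> T \<le> b I. It confines the spectrum to
  \<open>{a..b}\<close>, so that continuity on this interval can replace continuity on the spectrum
  throughout.\<close>

definition op_between :: "('h::complex_hilbert_space \<Rightarrow>\<^sub>L 'h) \<Rightarrow> real \<Rightarrow> real \<Rightarrow> bool"
  where "op_between T a b \<longleftrightarrow> self_adjoint T \<and>
    (\<forall>v. a * (norm v)\<^sup>2 \<le> expect T v \<and> expect T v \<le> b * (norm v)\<^sup>2)"

lemma expect_add: "expect (S + T) v = expect S v + expect T v"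
  and expect_diff: "expect (S - T) v = expect S v - expect T v"
  and expect_scaleR: "expect (r *\<^sub>R T) v = r * expect T v"
  and expect_id: "expect id_blinfun v = (norm v)\<^sup>2"
  and expect_0: "expect 0 v = 0"
  by (simp_all add: expect_def blinfun.bilinear_simps cinner_simps Re_cinner_self)

lemma expect_zero_right [simp]: "expect T 0 = 0" by (simp add: expect_def)

lemma abs_expect_le: "\<bar>expect T v\<bar> \<le> norm T * (norm v)\<^sup>2"
proof -
  have "\<bar>expect T v\<bar> \<le> norm (T v) * norm v" unfolding expect_def by (rule Re_cinner_le)
  also have "\<dots> \<le> norm T * norm v * norm v" by (intro mult_right_mono norm_blinfun) auto
  finally show ?thesis by (simp add: power2_eq_square)
qed

lemma expect_scale_vec: "expect T (r *\<^sub>R v) = r\<^sup>2 * expect T v"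
  by (simp add: expect_def blinfun.bilinear_simps cinner_simps power2_eq_square)

lemma bounded_ops_closed:
  shows "0 \<in> bounded_ops" "id_blinfun \<in> bounded_ops"
    and "S \<in> bounded_ops \<Longrightarrow> T \<in> bounded_ops \<Longrightarrow> S + T \<in> bounded_ops"
    and "S \<in> bounded_ops \<Longrightarrow> T \<in> bounded_ops \<Longrightarrow> S - T \<in> bounded_ops"
    and "T \<in> bounded_ops \<Longrightarrow> r *\<^sub>R T \<in> bounded_ops"
    and "S \<in> bounded_ops \<Longrightarrow> T \<in> bounded_ops \<Longrightarrow> S o\<^sub>L T \<in> bounded_ops"
  by (simp_all add: bounded_ops_def blinfun.bilinear_simps scaleC_add_right scaleC_diff_right scaleC_scaleR)

lemma self_adjoint_id: "self_adjoint id_blinfun"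
  by (simp add: self_adjoint_def bounded_ops_closed)

lemma self_adjoint_0: "self_adjoint 0"
  by (simp add: self_adjoint_def bounded_ops_closed)

lemma self_adjoint_add: "self_adjoint S \<Longrightarrow> self_adjoint T \<Longrightarrow> self_adjoint (S + T)"
  by (simp add: self_adjoint_def bounded_ops_closed blinfun.bilinear_simps cinner_simps)

lemma self_adjoint_scaleR: "self_adjoint T \<Longrightarrow> self_adjoint (r *\<^sub>R T)"
  by (simp add: self_adjoint_def bounded_ops_closed blinfun.bilinear_simps cinner_simps)

lemma self_adjoint_compose:
  assumes "self_adjoint S" "self_adjoint T" "S o\<^sub>L T = T o\<^sub>L S"
  shows "self_adjoint (S o\<^sub>L T)"
proof -
  have "S (T x) = T (S x)" for x using assms(3) by (metis blinfun_apply_blinfun_compose)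
  thus ?thesis using assms(1,2) by (simp add: self_adjoint_def bounded_ops_closed)
qed

text \<open>The limit in \<open>cfc\<close> is taken among real-linear operators; complex linearity
  survives because scalar multiplication is continuous.\<close>

lemma bounded_ops_limit:
  assumes "\<And>n. X n \<in> bounded_ops" "X \<longlonglongrightarrow> S"
  shows "S \<in> bounded_ops"
proof -
  have app: "(\<lambda>n. X n v) \<longlonglongrightarrow> S v" for v
    using assms(2) by (intro blinfun.tendsto tendsto_const)
  have bl: "bounded_linear (scaleC c :: 'a \<Rightarrow> 'a)" for c
    by (rule bounded_linear_intro[of _ "cmod c"]) (simp_all add: scaleC_add_right scaleC_scaleR norm_scaleC mult.commute)
  have "S (scaleC c v) = scaleC c (S v)" for c v
    using LIMSEQ_unique[OF app[of "scaleC c v"]] bounded_linear.tendsto[OF bl app[of v], of c] assms(1)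
    by (simp add: bounded_ops_scaleC)
  thus ?thesis by (simp add: bounded_ops_def)
qed

lemma tendsto_expect:
  assumes "(X \<longlongrightarrow> S) G"
  shows "((\<lambda>n. expect (X n) v) \<longlongrightarrow> expect S v) G"
  unfolding expect_def using assms by (intro tendsto_Re tendsto_cinner blinfun.tendsto tendsto_const)

lemma self_adjoint_limit:
  assumes "\<And>n. self_adjoint (X n)" "X \<longlonglongrightarrow> S"
  shows "self_adjoint S"
proof -
  have "S \<in> bounded_ops" using assms bounded_ops_limit unfolding self_adjoint_def by blast
  moreover have "cinner (S x) y = cinner x (S y)" for x y
  proof (rule LIMSEQ_unique)
    show "(\<lambda>n. cinner (X n x) y) \<longlonglongrightarrow> cinner (S x) y"
      using assms(2) by (intro tendsto_cinner blinfun.tendsto tendsto_const)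
    have "(\<lambda>n. cinner x (X n y)) \<longlonglongrightarrow> cinner x (S y)"
      using assms(2) by (intro tendsto_cinner blinfun.tendsto tendsto_const)
    thus "(\<lambda>n. cinner (X n x) y) \<longlonglongrightarrow> cinner x (S y)" using assms(1) by (simp add: self_adjoint_def)
  qed
  ultimately show ?thesis by (simp add: self_adjoint_def)
qed

text \<open>Reduces all matrix elements to diagonal ones. Both the symmetry of positive operators
  and the integrability of matrix elements of a positive family are derived this way.\<close>

lemma polarization:
  assumes "T \<in> bounded_ops"
  shows "4 * cinner (T x) y = cinner (T (x + y)) (x + y) - cinner (T (x - y)) (x - y)
    + \<i> * cinner (T (x + scaleC \<i> y)) (x + scaleC \<i> y) - \<i> * cinner (T (x - scaleC \<i> y)) (x - scaleC \<i> y)"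
  using assms by (simp add: blinfun.bilinear_simps cinner_simps bounded_ops_scaleC algebra_simps)

lemma self_adjoint_cinner_self:
  assumes "self_adjoint T"
  shows "cinner (T v) v = of_real (expect T v)"
proof -
  have "cinner (T v) v = cnj (cinner (T v) v)"
    using assms cinner_commute[of v "T v"] by (simp add: self_adjoint_def)
  thus ?thesis unfolding expect_def by (simp add: complex_eq_iff)
qed

text \<open>Positivity makes the diagonal real, so conjugating the polarization identity for (x, y)
  only changes the sign of its two imaginary terms. The facts \<open>e1\<close> to \<open>e3\<close>
  identify the result with the identity for (y, x), since the diagonal is unchanged under
  multiplication of the vector by \<i> or -1.\<close>

lemma positive_ops_self_adjoint:
  assumes "T \<in> positive_ops"
  shows "self_adjoint T"
proof -
  have T: "T \<in> bounded_ops" and pos: "\<And>x. cinner (T x) x \<in> \<real>\<^sub>\<ge>\<^sub>0"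
    using assms by (auto simp: positive_ops_def)
  have re: "cnj (cinner (T x) x) = cinner (T x) x" for x
    using pos[of x] by (metis Reals_cnj_iff nonneg_Reals_subset_Reals subsetD)
  have sw: "cinner (T (scaleC \<i> u)) (scaleC \<i> u) = cinner (T u) u" for u
    using T by (simp add: bounded_ops_scaleC cinner_simps)
  have "cnj (4 * cinner (T x) y) = 4 * cinner (T y) x" for x y
  proof -
    have e1: "cinner (T (y + scaleC \<i> x)) (y + scaleC \<i> x) = cinner (T (x - scaleC \<i> y)) (x - scaleC \<i> y)"
      using sw[of "x - scaleC \<i> y"] by (simp add: scaleC_diff_right scaleC_scaleC scaleC_minus_left add.commute)
    have e2: "cinner (T (y - scaleC \<i> x)) (y - scaleC \<i> x) = cinner (T (x + scaleC \<i> y)) (x + scaleC \<i> y)"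
      using sw[of "x + scaleC \<i> y"]
      by (simp add: scaleC_add_right scaleC_scaleC scaleC_minus_left)
         (metis (no_types) T blinfun.minus_right cinner_minus_left cinner_minus_right minus_diff_eq verit_minus_simplify(4))
    have e3: "cinner (T (y - x)) (y - x) = cinner (T (x - y)) (x - y)"
      by (metis (no_types) blinfun.minus_right cinner_minus_left cinner_minus_right minus_diff_eq verit_minus_simplify(4))
    show ?thesis
      unfolding polarization[OF T, of x y] polarization[OF T, of y x] e1 e2 e3
      by (simp add: re add.commute)
  qed
  hence "cnj (cinner (T x) y) = cinner (T y) x" for x y by (metis complex_cnj_mult complex_cnj_numeral mult_cancel_left zero_neq_numeral)
  hence "cinner (T x) y = cinner x (T y)" for x y by (metis cinner_commute)
  thus ?thesis using T by (simp add: self_adjoint_def)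
qed

lemma positive_ops_iff: "T \<in> positive_ops \<longleftrightarrow> self_adjoint T \<and> (\<forall>v. 0 \<le> expect T v)"
proof
  assume T: "T \<in> positive_ops"
  have "0 \<le> expect T v" for v
    using T unfolding positive_ops_def expect_def by (auto simp: complex_nonneg_Reals_iff)
  thus "self_adjoint T \<and> (\<forall>v. 0 \<le> expect T v)" using positive_ops_self_adjoint[OF T] by blast
next
  assume "self_adjoint T \<and> (\<forall>v. 0 \<le> expect T v)"
  thus "T \<in> positive_ops"
    by (auto simp: positive_ops_def self_adjoint_cinner_self) (simp add: self_adjoint_def)
qed

lemma positive_ops_between: "T \<in> positive_ops \<Longrightarrow> op_between T 0 (norm T)"
  using abs_expect_le[of T] by (auto simp: positive_ops_iff op_between_def abs_le_iff)

lemma op_between_positive: "op_between T 0 b \<Longrightarrow> T \<in> positive_ops"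
  by (auto simp: positive_ops_iff op_between_def)

subsection \<open>Spectra of self-adjoint operators\<close>

text \<open>\<open>x = x - t (S x - y)\<close> is a contraction for small \<open>t > 0\<close>.\<close>

lemma coercive_solution:
  fixes S :: "'h::complex_hilbert_space \<Rightarrow>\<^sub>L 'h"
  assumes "d > 0" and coer: "\<And>v. d * (norm v)\<^sup>2 \<le> expect S v"
  shows "\<exists>!x. S x = y"
proof -
  \<comment> \<open>The squared contraction factor is bounded by 1 - 2 t d + t^2 M^2, which is least
    at t = d / M^2, with value 1 - d^2 / M^2. Adding \<open>d\<close> to the norm ensures
    \<open>d \<le> M\<close>, so the square root defining \<open>c\<close> makes sense.\<close>
  define M where "M = norm S + d"
  define t where "t = d / M\<^sup>2"
  have M: "M > 0" "d \<le> M" unfolding M_def using assms(1) by (auto simp: add_nonneg_pos)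
  have t: "t > 0" unfolding t_def using M assms(1) by simp
  have dM: "d\<^sup>2 / M\<^sup>2 \<le> 1" "0 < d\<^sup>2 / M\<^sup>2" using M assms(1) by (simp_all add: power_mono)
  define c where "c = sqrt (1 - d\<^sup>2 / M\<^sup>2)"
  have c: "0 \<le> c" "c < 1" unfolding c_def using dM by (simp_all add: real_less_lsqrt)
  have contr: "norm (v - t *\<^sub>R S v) \<le> c * norm v" for v
  proof -
    have "norm (S v) \<le> M * norm v"
      using norm_blinfun[of S v] assms(1) unfolding M_def by (simp add: distrib_right add_increasing2)
    hence sq: "(norm (S v))\<^sup>2 \<le> M\<^sup>2 * (norm v)\<^sup>2" by (metis norm_ge_zero power_mono power_mult_distrib)
    have "(norm (v - t *\<^sub>R S v))\<^sup>2 = (norm v)\<^sup>2 - 2 * t * expect S v + t\<^sup>2 * (norm (S v))\<^sup>2"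
      unfolding norm_diff_square expect_def
      by (simp add: cinner_simps power_mult_distrib Re_cinner_commute[of v "S v"])
    also have "\<dots> \<le> (norm v)\<^sup>2 - 2 * t * (d * (norm v)\<^sup>2) + t\<^sup>2 * (M\<^sup>2 * (norm v)\<^sup>2)"
      using coer[of v] sq t by (intro add_mono diff_mono mult_left_mono) auto
    also have "\<dots> = (1 - d\<^sup>2 / M\<^sup>2) * (norm v)\<^sup>2"
      unfolding t_def using M by (simp add: field_simps power2_eq_square)
    also have "\<dots> = (c * norm v)\<^sup>2" unfolding c_def power_mult_distrib using dM by simp
    finally show ?thesis using c by (meson mult_nonneg_nonneg norm_ge_zero power2_le_imp_le)
  qed
  have "\<exists>!x. x - t *\<^sub>R (S x - y) = x"
  proof (rule banach_fix_type[OF c], intro allI)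
    fix x z
    have "(x - t *\<^sub>R (S x - y)) - (z - t *\<^sub>R (S z - y)) = (x - z) - t *\<^sub>R S (x - z)"
      by (simp add: blinfun.bilinear_simps algebra_simps)
    thus "dist (x - t *\<^sub>R (S x - y)) (z - t *\<^sub>R (S z - y)) \<le> c * dist x z"
      unfolding dist_norm by (simp only: contr)
  qed
  moreover have "x - t *\<^sub>R (S x - y) = x \<longleftrightarrow> S x = y" for x using t by auto
  ultimately show ?thesis by simp
qed

text \<open>Unique solvability makes the solution map linear, and d |u|^2 \<le> Re <S u, u> \<le> |S
  u| |u| bounds it by 1 / d.\<close>

lemma coercive_inverse:
  fixes S :: "'h::complex_hilbert_space \<Rightarrow>\<^sub>L 'h"
  assumes "d > 0" and coer: "\<And>v. d * (norm v)\<^sup>2 \<le> expect S v" and S: "S \<in> bounded_ops"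
  shows "\<exists>R \<in> bounded_ops. \<forall>x. blinfun_apply R (S x) = x \<and> S (R x) = x"
proof -
  note ex1 = coercive_solution[of d S, OF assms(1,2)]
  define f where "f y = (THE x. S x = y)" for y
  have Sf: "S (f y) = y" for y unfolding f_def by (rule theI'[OF ex1])
  have inj: "S x = S z \<Longrightarrow> x = z" for x z using ex1[of "S z"] by blast
  have bl: "bounded_linear f"
  proof (rule bounded_linear_intro[of _ "1 / d"])
    show "f (x + y) = f x + f y" for x y by (rule inj) (simp add: Sf blinfun.bilinear_simps)
    show "f (r *\<^sub>R x) = r *\<^sub>R f x" for r x by (rule inj) (simp add: Sf blinfun.bilinear_simps)
    show "norm (f x) \<le> norm x * (1 / d)" for x
    proof (cases "f x = 0")
      case False
      have "d * (norm (f x))\<^sup>2 \<le> expect S (f x)" by (rule coer)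
      also have "\<dots> \<le> norm x * norm (f x)"
        using Re_cinner_le[of x "f x"] unfolding expect_def Sf by linarith
      finally have "d * norm (f x) \<le> norm x" using False by (simp add: power2_eq_square)
      thus ?thesis using assms(1) by (simp add: field_simps)
    qed (use assms(1) in simp)
  qed
  have app: "blinfun_apply (Blinfun f) = f" by (rule bounded_linear_Blinfun_apply[OF bl])
  have "f (scaleC c x) = scaleC c (f x)" for c x
    by (rule inj) (simp add: Sf bounded_ops_scaleC[OF S])
  hence "Blinfun f \<in> bounded_ops" by (simp add: bounded_ops_def app)
  moreover have "f (S x) = x" for x by (rule inj) (simp add: Sf)
  ultimately show ?thesis by (intro bexI[of _ "Blinfun f"]) (simp_all add: app Sf)
qed

text \<open>Exactly the set on which \<open>cfc\<close> demands uniform convergence.\<close>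

definition real_spectrum :: "('h::complex_hilbert_space \<Rightarrow>\<^sub>L 'h) \<Rightarrow> real set"
  where "real_spectrum T = {r. complex_of_real r \<in> spectrum T}"

text \<open>For r below a the operator T - r is coercive with constant a - r, and for r above b the
  operator r - T is coercive with constant r - b; either way r lies in the resolvent set.\<close>

lemma real_spectrum_between:
  assumes T: "op_between T a b"
  shows "real_spectrum T \<subseteq> {a..b}"
proof
  fix r assume "r \<in> real_spectrum T"
  hence r: "\<not> (\<exists>S. S \<in> bounded_ops \<and> (\<forall>x. blinfun_apply S (T x - r *\<^sub>R x) = x \<and> T (S x) - r *\<^sub>R (S x) = x))"
    by (simp add: real_spectrum_def spectrum_def scaleC_of_real)
  have bo: "T \<in> bounded_ops" using T by (simp add: op_between_def self_adjoint_def)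
  have bd: "a * (norm v)\<^sup>2 \<le> expect T v" "expect T v \<le> b * (norm v)\<^sup>2" for v
    using T by (auto simp: op_between_def)
  show "r \<in> {a..b}"
  proof (rule ccontr)
    assume "r \<notin> {a..b}"
    then consider "r < a" | "r > b" by force
    thus False
    proof cases
      case 1
      have "\<exists>R \<in> bounded_ops. \<forall>x. blinfun_apply R ((T - r *\<^sub>R id_blinfun) x) = x \<and> (T - r *\<^sub>R id_blinfun) (R x) = x"
        using 1 bo bd
        by (intro coercive_inverse[of "a - r"])
           (auto simp: expect_diff expect_scaleR expect_id left_diff_distrib intro!: bounded_ops_closed)
      thus False using r by (auto simp: blinfun.bilinear_simps)
    next
      case 2
      have "\<exists>R \<in> bounded_ops. \<forall>x. blinfun_apply R ((r *\<^sub>R id_blinfun - T) x) = x \<and> (r *\<^sub>R id_blinfun - T) (R x) = x"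
        using 2 bo bd
        by (intro coercive_inverse[of "r - b"])
           (auto simp: expect_diff expect_scaleR expect_id left_diff_distrib intro!: bounded_ops_closed)
      then obtain R where R: "R \<in> bounded_ops" "\<And>x. blinfun_apply R (r *\<^sub>R x - T x) = x" "\<And>x. r *\<^sub>R R x - T (R x) = x"
        by (auto simp: blinfun.bilinear_simps)
      have "- R \<in> bounded_ops" using bounded_ops_closed(5)[OF R(1), of "-1"] by simp
      moreover have "(- R) (T x - r *\<^sub>R x) = x \<and> T ((- R) x) - r *\<^sub>R ((- R) x) = x" for x
        using R(2)[of x] R(3)[of x] by (simp add: blinfun.bilinear_simps algebra_simps)
      ultimately show False using r by blast
    qed
  qed
qed

section \<open>Polynomials of an operator and their spectral bounds\<close>

lemma poly_op_0 [simp]: "poly_op 0 T = 0"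
  by (simp add: poly_op_def)

lemma poly_op_pCons: "poly_op (pCons a q) T = a *\<^sub>R id_blinfun + (T o\<^sub>L poly_op q T)"
proof (cases "q = 0")
  case False
  have "(\<Sum>i\<le>degree q. coeff q i *\<^sub>R (T o\<^sub>L ((\<lambda>S. T o\<^sub>L S) ^^ i) id_blinfun)) = (T o\<^sub>L poly_op q T)"
    unfolding poly_op_def by (intro blinfun_eqI) (simp add: blinfun.sum_left blinfun.sum_right blinfun.bilinear_simps)
  thus ?thesis using False unfolding poly_op_def by (simp add: sum.atMost_Suc_shift del: sum.atMost_Suc)
qed (auto simp: poly_op_def)

lemma poly_op_add: "poly_op (p + q) T = poly_op p T + poly_op q T"
  by (induction p q rule: poly_induct2) (auto simp: poly_op_pCons blinfun.bilinear_simps algebra_simps intro!: blinfun_eqI)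

lemma poly_op_smult: "poly_op (smult c q) T = c *\<^sub>R poly_op q T"
  by (induction q) (auto simp: poly_op_pCons blinfun.bilinear_simps algebra_simps intro!: blinfun_eqI)

lemma poly_op_diff: "poly_op (p - q) T = poly_op p T - poly_op q T"
  using poly_op_add[of "p - q" q T] by simp

lemma poly_op_mult: "poly_op (p * q) T = (poly_op p T o\<^sub>L poly_op q T)"
  by (induction p)
     (auto simp: poly_op_pCons poly_op_add poly_op_smult blinfun.bilinear_simps algebra_simps intro!: blinfun_eqI)

lemma self_adjoint_poly_op:
  assumes "self_adjoint T"
  shows "self_adjoint (poly_op q T)"
proof (induction q)
  case (pCons a q)
  \<comment> \<open>Writing \<open>T\<close> as a polynomial of itself turns its commutation with
    \<open>poly_op q T\<close> into commutativity of polynomial multiplication.\<close>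
  have X: "poly_op [:0, 1:] T = T"
    by (intro blinfun_eqI) (simp add: poly_op_pCons blinfun.bilinear_simps)
  have "(T o\<^sub>L poly_op q T) = (poly_op q T o\<^sub>L T)"
    using poly_op_mult[of "[:0, 1:]" q T] poly_op_mult[of q "[:0, 1:]" T]
    unfolding X mult.commute[of q] by simp
  thus ?case unfolding poly_op_pCons
    using assms pCons by (intro self_adjoint_add self_adjoint_scaleR self_adjoint_id self_adjoint_compose)
qed (simp add: self_adjoint_0)

text \<open>Horner evaluation with complex coefficients, which the factorisation into linear factors
  requires. The values are plain functions because \<open>scaleC\<close> acts on vectors and not on
  the operator type.\<close>

definition cpoly_apply :: "complex poly \<Rightarrow> ('h::complex_hilbert_space \<Rightarrow>\<^sub>L 'h) \<Rightarrow> 'h \<Rightarrow> 'h"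
  where "cpoly_apply q T = fold_coeffs (\<lambda>a f v. scaleC a v + T (f v)) q (\<lambda>_. 0)"

lemma cpoly_apply_0 [simp]: "cpoly_apply 0 T v = 0"
  by (simp add: cpoly_apply_def)

lemma cpoly_apply_pCons: "cpoly_apply (pCons a q) T v = scaleC a v + T (cpoly_apply q T v)"
  by (cases "q = 0 \<and> a = 0") (auto simp: cpoly_apply_def)

lemma cpoly_apply_add: "cpoly_apply (p + q) T v = cpoly_apply p T v + cpoly_apply q T v"
  by (induction p q rule: poly_induct2)
     (simp_all add: cpoly_apply_pCons blinfun.bilinear_simps scaleC_add_left algebra_simps)

lemma cpoly_apply_smult:
  "T \<in> bounded_ops \<Longrightarrow> cpoly_apply (smult c q) T v = scaleC c (cpoly_apply q T v)"
  by (induction q)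
     (simp_all add: cpoly_apply_pCons bounded_ops_scaleC scaleC_scaleC scaleC_add_right)

lemma poly_op_conv_cpoly_apply: "poly_op q T v = cpoly_apply (map_poly of_real q) T v"
  by (induction q)
     (simp_all add: cpoly_apply_pCons poly_op_pCons map_poly_pCons blinfun.bilinear_simps scaleC_of_real)

lemma poly_map_of_real: "poly (map_poly complex_of_real q) (of_real r) = of_real (poly q r)"
  by (induction q) (simp_all add: map_poly_pCons)

text \<open>The fundamental theorem of algebra splits off one linear factor at a time, and a
  composition of maps bounded below is bounded below by the product of the constants.\<close>

lemma cpoly_apply_bounded_below:
  assumes T: "T \<in> bounded_ops" and "q \<noteq> 0"
    and "\<And>z. poly q z = 0 \<Longrightarrow> \<exists>c>0. \<forall>v. c * norm v \<le> norm (T v - scaleC z v)"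
  shows "\<exists>c>0. \<forall>v. c * norm v \<le> norm (cpoly_apply q T v)"
  using assms(2,3)
proof (induction "degree q" arbitrary: q)
  case 0
  then obtain a where "q = [:a:]" by (metis degree_0_id)
  thus ?case using 0(2) by (intro exI[of _ "cmod a"]) (auto simp: cpoly_apply_pCons norm_scaleC)
next
  case (Suc n)
  have "\<not> constant (poly q)" using Suc(2) by (simp add: constant_degree)
  then obtain z where z: "poly q z = 0" using fundamental_theorem_of_algebra by blast
  then obtain q' where q': "q = [:- z, 1:] * q'" using poly_eq_0_iff_dvd by (metis dvdE)
  have "q' \<noteq> 0" using Suc(3) q' by auto
  have "degree q = Suc (degree q')" unfolding q' using \<open>q' \<noteq> 0\<close> by (subst degree_mult_eq) auto
  hence "n = degree q'" using Suc(2) by simp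
  from Suc(1)[OF this \<open>q' \<noteq> 0\<close>] Suc(4) obtain c where
    c: "c > 0" "\<And>v. c * norm v \<le> norm (cpoly_apply q' T v)" unfolding q' by auto
  obtain d where d: "d > 0" "\<And>v. d * norm v \<le> norm (T v - scaleC z v)" using Suc(4)[OF z] by blast
  have eq: "cpoly_apply q T v = T (cpoly_apply q' T v) - scaleC z (cpoly_apply q' T v)" for v
    using cpoly_apply_add[of "smult (- z) q'" "pCons 0 q'" T v]
    unfolding q' by (simp add: cpoly_apply_pCons cpoly_apply_smult[OF T] scaleC_minus_left del: smult_minus_left)
  have "d * c * norm v \<le> norm (cpoly_apply q T v)" for v
  proof -
    have "d * c * norm v \<le> d * norm (cpoly_apply q' T v)" using c(2)[of v] d(1) by simp
    also have "\<dots> \<le> norm (cpoly_apply q T v)" unfolding eq by (rule d)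
    finally show ?thesis .
  qed
  thus ?case using c(1) d(1) by (intro exI[of _ "d * c"]) simp
qed

text \<open>At a real point the bounded inverse gives the estimate. At a non-real point it comes
  from Im <(T - z) v, v> = - Im z |v|^2, so no statement about the non-real part of the spectrum is
  required.\<close>

lemma bounded_below_outside_spectrum:
  assumes T: "self_adjoint T" and z: "z \<notin> of_real ` real_spectrum T"
  shows "\<exists>c>0. \<forall>v. c * norm v \<le> norm (T v - scaleC z v)"
proof (cases "Im z = 0")
  case True
  then obtain r where r: "z = of_real r" by (metis complex_is_Real_iff Reals_cases)
  hence "of_real r \<notin> spectrum T" using z by (auto simp: real_spectrum_def)
  then obtain S where S: "\<And>x. blinfun_apply S (T x - scaleC z x) = x"
    unfolding r spectrum_def by auto
  \<comment> \<open>The \<open>+ 1\<close> keeps the denominator positive when \<open>S = 0\<close>,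
    as happens on the trivial space.\<close>
  have "1 / (norm S + 1) * norm v \<le> norm (T v - scaleC z v)" for v
  proof -
    have "norm v \<le> norm S * norm (T v - scaleC z v)" using norm_blinfun[of S] S by metis
    also have "\<dots> \<le> (norm S + 1) * norm (T v - scaleC z v)" by (intro mult_right_mono) auto
    finally show ?thesis using norm_ge_zero[of S] by (simp add: pos_divide_le_eq add_nonneg_pos mult.commute)
  qed
  thus ?thesis by (intro exI[of _ "1 / (norm S + 1)"]) (simp add: add_nonneg_pos)
next
  case False
  have "\<bar>Im z\<bar> * norm v \<le> norm (T v - scaleC z v)" for v
  proof (cases "v = 0")
    case False
    have "cinner (T v - scaleC z v) v = of_real (expect T v) - z * of_real ((norm v)\<^sup>2)"
      by (simp only: cinner_simps self_adjoint_cinner_self[OF T] cinner_self)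
    hence "Im (cinner (T v - scaleC z v) v) = - Im z * (norm v)\<^sup>2" by (simp del: of_real_power)
    hence "\<bar>Im z\<bar> * (norm v)\<^sup>2 \<le> norm (T v - scaleC z v) * norm v"
      using abs_Im_le_cmod[of "cinner (T v - scaleC z v) v"] cauchy_schwarz[of "T v - scaleC z v" v]
      by (simp add: abs_mult)
    thus ?thesis using False by (simp add: power2_eq_square)
  qed simp
  thus ?thesis using False by (intro exI[of _ "\<bar>Im z\<bar>"]) simp
qed

text \<open>Positivity of the form of P at the vector v - t P v with t = 1 / |P|, which minimises
  the resulting quadratic bound in t.\<close>

lemma positive_norm_square_le:
  assumes P: "P \<in> positive_ops"
  shows "(norm (P v))\<^sup>2 \<le> norm P * expect P v"
proof (cases "P = 0")
  case False
  hence n: "norm P > 0" by simp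
  define t where "t = 1 / norm P"
  have sa: "cinner (P x) y = cinner x (P y)" for x y
    using P by (simp add: positive_ops_iff self_adjoint_def)
  have "0 \<le> expect P (v - t *\<^sub>R P v)" using P by (simp add: positive_ops_iff)
  also have "\<dots> = expect P v - 2 * t * (norm (P v))\<^sup>2 + t\<^sup>2 * expect P (P v)"
    unfolding expect_def using sa[of "P v" v]
    by (simp add: blinfun.bilinear_simps cinner_simps Re_cinner_self power2_eq_square algebra_simps)
  also have "\<dots> \<le> expect P v - 2 * t * (norm (P v))\<^sup>2 + t\<^sup>2 * (norm P * (norm (P v))\<^sup>2)"
    using abs_expect_le[of P "P v"] by (intro add_left_mono mult_left_mono) auto
  also have "\<dots> = expect P v - (norm (P v))\<^sup>2 / norm P"
    unfolding t_def using n by (simp add: field_simps power2_eq_square)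
  finally show ?thesis using n by (simp add: field_simps)
qed simp

text \<open>If \<open>P = S - m \<ge> 0\<close> were bounded below, then \<open>\<parallel>P v\<parallel>\<^sup>2 \<le> \<parallel>P\<parallel> \<langle>P v, v\<rangle>\<close> would raise the infimum \<open>m\<close> of the
  numerical range.\<close>

lemma numerical_range_bottom:
  fixes S :: "'h::complex_hilbert_space \<Rightarrow>\<^sub>L 'h"
  assumes S: "self_adjoint S" and v0: "v0 \<noteq> (0::'h)"
  shows "\<exists>m. (\<forall>v. m * (norm v)\<^sup>2 \<le> expect S v) \<and> \<not> (\<exists>c>0. \<forall>v. c * norm v \<le> norm (S v - m *\<^sub>R v))"
proof -
  define X where "X = expect S ` {v. norm v = 1}"
  define m where "m = Inf X"
  have bdd: "bdd_below X"
  proof (rule bdd_belowI)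
    fix x assume "x \<in> X"
    then obtain v where "norm v = 1" "x = expect S v" by (auto simp: X_def)
    thus "- norm S \<le> x" using abs_expect_le[of S v] by simp
  qed
  have ne: "X \<noteq> {}" unfolding X_def using v0 by (auto intro!: exI[of _ "(1 / norm v0) *\<^sub>R v0"])
  have ge: "m * (norm v)\<^sup>2 \<le> expect S v" for v
  proof (cases "v = 0")
    case False
    have "m \<le> expect S ((1 / norm v) *\<^sub>R v)"
      unfolding m_def using False by (intro cInf_lower[OF _ bdd]) (auto simp: X_def)
    thus ?thesis using False by (simp add: expect_scale_vec power_divide field_simps)
  qed simp
  define P where "P = S - m *\<^sub>R id_blinfun"
  have eP: "expect P v = expect S v - m * (norm v)\<^sup>2" for v
    by (simp add: P_def expect_diff expect_scaleR expect_id)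
  have "self_adjoint P"
    using self_adjoint_add[OF S self_adjoint_scaleR[OF self_adjoint_id], of "- m"] by (simp add: P_def)
  hence P: "P \<in> positive_ops" using ge by (simp add: positive_ops_iff eP)
  have False if c: "c > 0" "\<And>v. c * norm v \<le> norm (S v - m *\<^sub>R v)" for c
  proof -
    have "m + c\<^sup>2 / (norm P + 1) \<le> x" if x: "x \<in> X" for x
    proof -
      obtain v where v: "norm v = 1" "x = expect S v" using x by (auto simp: X_def)
      have "P v = S v - m *\<^sub>R v" by (simp add: P_def blinfun.bilinear_simps)
      hence "c \<le> norm (P v)" using c(2)[of v] v by simp
      hence "c\<^sup>2 \<le> (norm (P v))\<^sup>2" using c(1) by (intro power_mono) auto
      also have "\<dots> \<le> norm P * expect P v" by (rule positive_norm_square_le[OF P])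
      also have "\<dots> \<le> (norm P + 1) * expect P v" using P by (intro mult_right_mono) (auto simp: positive_ops_iff)
      finally have "c\<^sup>2 / (norm P + 1) \<le> expect P v"
        using norm_ge_zero[of P] by (simp add: pos_divide_le_eq add_nonneg_pos mult.commute)
      thus ?thesis unfolding eP v by (simp add: v(1))
    qed
    hence "m + c\<^sup>2 / (norm P + 1) \<le> m" unfolding m_def by (intro cInf_greatest[OF ne])
    thus False using c(1) norm_ge_zero[of P] by (simp add: divide_le_0_iff)
  qed
  thus ?thesis using ge by blast
qed

text \<open>If no point of the real spectrum were a root of q - m, with m the bottom of the
  numerical range of q(T), every linear factor of q - m, and hence q(T) - m, would be bounded below.
  The vector \<open>v0\<close> excludes the trivial space, where the spectrum is empty.\<close>

lemma bottom_in_poly_spectrum: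
  fixes T :: "'h::complex_hilbert_space \<Rightarrow>\<^sub>L 'h"
  assumes T: "self_adjoint T" and v0: "v0 \<noteq> (0::'h)"
  shows "\<exists>r\<in>real_spectrum T. \<forall>v. poly q r * (norm v)\<^sup>2 \<le> expect (poly_op q T) v"
proof -
  have main: "\<exists>m. (\<forall>v. m * (norm v)\<^sup>2 \<le> expect (poly_op q T) v) \<and> (q = [:m:] \<or> (\<exists>r\<in>real_spectrum T. poly q r = m))" for q
  proof -
    obtain m where m: "\<forall>v. m * (norm v)\<^sup>2 \<le> expect (poly_op q T) v"
        "\<not> (\<exists>c>0. \<forall>v. c * norm v \<le> norm (poly_op q T v - m *\<^sub>R v))"
      using numerical_range_bottom[OF self_adjoint_poly_op[OF T] v0] by blast
    have "\<exists>r\<in>real_spectrum T. poly q r = m" if "q \<noteq> [:m:]"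
    proof (rule ccontr)
      assume no: "\<not> ?thesis"
      have nz: "map_poly complex_of_real (q - [:m:]) \<noteq> 0"
        using that by (subst map_poly_eq_0_iff) auto
      have "\<exists>c>0. \<forall>v. c * norm v \<le> norm (cpoly_apply (map_poly of_real (q - [:m:])) T v)"
      proof (rule cpoly_apply_bounded_below[OF _ nz])
        show "T \<in> bounded_ops" using T by (simp add: self_adjoint_def)
        fix z assume z: "poly (map_poly complex_of_real (q - [:m:])) z = 0"
        have "z \<notin> of_real ` real_spectrum T"
          using z no by (auto simp: poly_map_of_real)
        thus "\<exists>c>0. \<forall>v. c * norm v \<le> norm (T v - scaleC z v)" by (rule bounded_below_outside_spectrum[OF T])
      qed
      thus False using m(2) unfolding poly_op_conv_cpoly_apply[symmetric]
        by (simp add: poly_op_diff poly_op_pCons blinfun.bilinear_simps)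
    qed
    thus ?thesis using m(1) by blast
  qed
  \<comment> \<open>For constant \<open>q\<close> any spectral point will do; the polynomial X,
    which is not constant, supplies one.\<close>
  obtain r0 where r0: "r0 \<in> real_spectrum T" using main[of "[:0, 1:]"] by auto
  obtain m where m: "\<forall>v. m * (norm v)\<^sup>2 \<le> expect (poly_op q T) v" "q = [:m:] \<or> (\<exists>r\<in>real_spectrum T. poly q r = m)"
    using main by blast
  have "\<exists>r\<in>real_spectrum T. poly q r = m" using m(2) r0 by (metis poly_pCons poly_0 mult_zero_right add.right_neutral)
  thus ?thesis using m(1) by blast
qed

lemma poly_op_ge:
  fixes T :: "'h::complex_hilbert_space \<Rightarrow>\<^sub>L 'h"
  assumes T: "self_adjoint T" and c: "\<And>r. r \<in> real_spectrum T \<Longrightarrow> c \<le> poly q r"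
  shows "c * (norm v)\<^sup>2 \<le> expect (poly_op q T) v"
proof (cases "v = 0")
  case False
  obtain r where r: "r \<in> real_spectrum T" "poly q r * (norm v)\<^sup>2 \<le> expect (poly_op q T) v"
    using bottom_in_poly_spectrum[OF T False] by blast
  have "c * (norm v)\<^sup>2 \<le> poly q r * (norm v)\<^sup>2" using c[OF r(1)] by (intro mult_right_mono) auto
  thus ?thesis using r(2) by linarith
qed simp

text \<open>The polynomial c^2 - q^2 is nonnegative on the spectrum, and its expectation at v is c^2
  |v|^2 - |q(T) v|^2 because q(T) is self-adjoint.\<close>

lemma norm_poly_op_le:
  assumes T: "self_adjoint T" and c: "\<And>r. r \<in> real_spectrum T \<Longrightarrow> \<bar>poly q r\<bar> \<le> c" and "0 \<le> c"
  shows "norm (poly_op q T) \<le> c"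
proof (rule norm_blinfun_bound[OF assms(3)])
  fix v
  have sa: "self_adjoint (poly_op q T)" by (rule self_adjoint_poly_op[OF T])
  have "0 * (norm v)\<^sup>2 \<le> expect (poly_op ([:c\<^sup>2:] - q * q) T) v"
  proof (rule poly_op_ge[OF T])
    fix r assume "r \<in> real_spectrum T"
    hence "(poly q r)\<^sup>2 \<le> c\<^sup>2" using c[of r] assms(3) by (metis abs_le_square_iff abs_of_nonneg)
    thus "0 \<le> poly ([:c\<^sup>2:] - q * q) r" by (simp add: power2_eq_square)
  qed
  also have "expect (poly_op ([:c\<^sup>2:] - q * q) T) v = c\<^sup>2 * (norm v)\<^sup>2 - (norm (poly_op q T v))\<^sup>2"
    using sa by (simp add: poly_op_diff poly_op_mult poly_op_pCons expect_diff expect_add expect_scaleR expect_id)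
      (metis Re_cinner_commute Re_cinner_self expect_def self_adjoint_def blinfun_apply_blinfun_compose)
  finally have "(norm (poly_op q T v))\<^sup>2 \<le> (c * norm v)\<^sup>2" by (simp add: power_mult_distrib)
  thus "norm (poly_op q T v) \<le> c * norm v" using assms(3) by (meson mult_nonneg_nonneg norm_ge_zero power2_le_imp_le)
qed

subsection \<open>The continuous functional calculus\<close>

lemma poly_op_Cauchy:
  assumes T: "self_adjoint T" and "uniformly_Cauchy_on (real_spectrum T) (\<lambda>n. poly (q n))"
  shows "convergent (\<lambda>n. poly_op (q n) T)"
proof -
  have "Cauchy (\<lambda>n. poly_op (q n) T)"
  proof (rule metric_CauchyI)
    fix e :: real assume e: "e > 0"
    then obtain M where M: "\<And>r m n. r \<in> real_spectrum T \<Longrightarrow> m \<ge> M \<Longrightarrow> n \<ge> M \<Longrightarrow> dist (poly (q m) r) (poly (q n) r) < e / 2"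
      using assms(2) unfolding uniformly_Cauchy_on_def by (meson half_gt_zero)
    have "dist (poly_op (q m) T) (poly_op (q n) T) < e" if "m \<ge> M" "n \<ge> M" for m n
    proof -
      have "norm (poly_op (q m - q n) T) \<le> e / 2"
        using M[OF _ that] e by (intro norm_poly_op_le[OF T]) (auto simp: dist_real_def less_imp_le)
      thus ?thesis using e by (simp add: dist_norm poly_op_diff)
    qed
    thus "\<exists>M. \<forall>m\<ge>M. \<forall>n\<ge>M. dist (poly_op (q m) T) (poly_op (q n) T) < e" by blast
  qed
  thus ?thesis by (simp add: Cauchy_convergent_iff)
qed

text \<open>Stated for two functions so that it serves twice: with f = g and c = 0 it gives
  uniqueness of the operator selected by \<open>THE\<close> in \<open>cfc\<close>, and in general it
  gives norm continuity of the calculus.\<close>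

lemma norm_poly_op_limit_le:
  assumes T: "self_adjoint T"
    and p: "uniform_limit (real_spectrum T) (\<lambda>n. poly (p n)) f sequentially" "(\<lambda>n. poly_op (p n) T) \<longlonglongrightarrow> A"
    and q: "uniform_limit (real_spectrum T) (\<lambda>n. poly (q n)) g sequentially" "(\<lambda>n. poly_op (q n) T) \<longlonglongrightarrow> B"
    and c: "\<And>r. r \<in> real_spectrum T \<Longrightarrow> \<bar>f r - g r\<bar> \<le> c" "0 \<le> c"
  shows "norm (A - B) \<le> c"
proof (rule field_le_epsilon)
  fix e :: real assume e: "e > 0"
  have "\<forall>\<^sub>F n in sequentially. norm (poly_op (p n) T - poly_op (q n) T) \<le> c + e"
    using uniform_limitD[OF p(1) half_gt_zero[OF e]] uniform_limitD[OF q(1) half_gt_zero[OF e]]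
  proof eventually_elim
    case (elim n)
    have "norm (poly_op (p n - q n) T) \<le> c + e"
    proof (rule norm_poly_op_le[OF T])
      fix r assume r: "r \<in> real_spectrum T"
      thus "\<bar>poly (p n - q n) r\<bar> \<le> c + e"
        using bspec[OF elim(1) r] bspec[OF elim(2) r] c(1)[OF r] unfolding dist_real_def poly_diff by linarith
    qed (use c e in simp)
    thus ?case by (simp add: poly_op_diff)
  qed
  moreover have "(\<lambda>n. norm (poly_op (p n) T - poly_op (q n) T)) \<longlonglongrightarrow> norm (A - B)"
    using p(2) q(2) by (intro tendsto_intros)
  ultimately show "norm (A - B) \<le> c + e" by (intro tendsto_upperbound) auto
qed

lemma cfc_eqI:
  assumes T: "self_adjoint T"
    and q: "uniform_limit (real_spectrum T) (\<lambda>n. poly (q n)) f sequentially" "(\<lambda>n. poly_op (q n) T) \<longlonglongrightarrow> S"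
  shows "cfc f T = S"
  unfolding cfc_def real_spectrum_def[symmetric]
proof (rule the_equality)
  show "\<exists>q. uniform_limit (real_spectrum T) (\<lambda>n. poly (q n)) f sequentially \<and> (\<lambda>n. poly_op (q n) T) \<longlonglongrightarrow> S"
    using q by blast
  fix R assume "\<exists>q. uniform_limit (real_spectrum T) (\<lambda>n. poly (q n)) f sequentially \<and> (\<lambda>n. poly_op (q n) T) \<longlonglongrightarrow> R"
  then obtain p where p: "uniform_limit (real_spectrum T) (\<lambda>n. poly (p n)) f sequentially" "(\<lambda>n. poly_op (p n) T) \<longlonglongrightarrow> R"
    by blast
  show "R = S" using norm_poly_op_limit_le[OF T p q, of 0] by simp
qed

text \<open>The existence half: convergence on the interval restricts to the spectrum, where the
  norm estimate makes the operators a Cauchy sequence.\<close>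

lemma cfc_tendsto:
  assumes T: "op_between T a b" and q: "uniform_limit {a..b} (\<lambda>n. poly (q n)) f sequentially"
  shows "(\<lambda>n. poly_op (q n) T) \<longlonglongrightarrow> cfc f T"
proof -
  have sa: "self_adjoint T" using T by (simp add: op_between_def)
  have u: "uniform_limit (real_spectrum T) (\<lambda>n. poly (q n)) f sequentially"
    by (rule uniform_limit_on_subset[OF q real_spectrum_between[OF T]])
  hence "uniformly_Cauchy_on (real_spectrum T) (\<lambda>n. poly (q n))"
    by (intro uniformly_convergent_Cauchy) (auto simp: uniformly_convergent_on_def)
  then obtain S where "(\<lambda>n. poly_op (q n) T) \<longlonglongrightarrow> S" using poly_op_Cauchy[OF sa] convergent_def by blast
  thus ?thesis using cfc_eqI[OF sa u] by simp
qed

lemma polynomial_approximation: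
  fixes f :: "real \<Rightarrow> real"
  assumes "continuous_on {a..b} f"
  shows "\<exists>q :: nat \<Rightarrow> real poly. uniform_limit {a..b} (\<lambda>n. poly (q n)) f sequentially"
proof -
  have "\<exists>q :: real poly. \<forall>x\<in>{a..b}. \<bar>f x - poly q x\<bar> < e" if "e > 0" for e
  proof -
    have "\<exists>g. (\<exists>q :: real poly. g = poly q) \<and> (\<forall>x\<in>{a..b}. \<bar>f x - g x\<bar> < e)"
    proof (rule Stone_Weierstrass_HOL[where f = f])
      show "\<exists>q :: real poly. (\<lambda>x. c) = poly q" for c by (rule exI[of _ "[:c:]"]) auto
      show "\<exists>q :: real poly. (\<lambda>x. f x + g x) = poly q"
        if fg: "(\<exists>q. f = poly q) \<and> (\<exists>q. g = poly q)" for f g :: "real \<Rightarrow> real"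
      proof -
        obtain p q where "f = poly p" "g = poly q" using fg by blast
        thus ?thesis by (intro exI[of _ "p + q"]) auto
      qed
      show "\<exists>q :: real poly. (\<lambda>x. f x * g x) = poly q"
        if fg: "(\<exists>q. f = poly q) \<and> (\<exists>q. g = poly q)" for f g :: "real \<Rightarrow> real"
      proof -
        obtain p q where "f = poly p" "g = poly q" using fg by blast
        thus ?thesis by (intro exI[of _ "p * q"]) auto
      qed
      show "\<exists>f. (\<exists>q :: real poly. f = poly q) \<and> f x \<noteq> f y" if "x \<in> {a..b} \<and> y \<in> {a..b} \<and> x \<noteq> y" for x y
        using that by (intro exI[of _ "poly [:0, 1:]"]) auto
      show "continuous_on {a..b} g" if "\<exists>q :: real poly. g = poly q" for g
        using that by (auto intro!: continuous_intros)
    qed (use assms that in auto)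
    thus ?thesis by blast
  qed
  hence "\<forall>n. \<exists>q :: real poly. \<forall>x\<in>{a..b}. \<bar>f x - poly q x\<bar> < 1 / Suc n" by simp
  then obtain q :: "nat \<Rightarrow> real poly" where q: "\<And>n x. x \<in> {a..b} \<Longrightarrow> \<bar>f x - poly (q n) x\<bar> < 1 / Suc n" by metis
  have "uniform_limit {a..b} (\<lambda>n. poly (q n)) f sequentially"
  proof (rule uniform_limitI)
    fix e :: real assume "e > 0"
    hence "\<forall>\<^sub>F n in sequentially. 1 / real (Suc n) < e"
      using order_tendstoD(2)[OF LIMSEQ_Suc[OF lim_1_over_n]] by blast
    thus "\<forall>\<^sub>F n in sequentially. \<forall>x\<in>{a..b}. dist (poly (q n) x) (f x) < e"
    proof eventually_elim
      case (elim n)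
      show ?case
      proof
        fix x assume "x \<in> {a..b}"
        from q[OF this, of n] elim show "dist (poly (q n) x) (f x) < e" unfolding dist_real_def by linarith
      qed
    qed
  qed
  thus ?thesis by blast
qed

section \<open>Algebra, order and continuity of the functional calculus\<close>

lemma cfc_poly: "op_between T a b \<Longrightarrow> cfc (poly q) T = poly_op q T"
  using cfc_tendsto[of T a b "\<lambda>_. q" "poly q"] LIMSEQ_unique[OF tendsto_const]
  by (metis uniform_limit_const)

context
  fixes T :: "'h::complex_hilbert_space \<Rightarrow>\<^sub>L 'h" and a b :: real
  assumes T: "op_between T a b"
begin

lemma cfc_approximation:
  assumes "continuous_on {a..b} f"
  obtains q where "uniform_limit {a..b} (\<lambda>n. poly (q n)) f sequentially" "(\<lambda>n. poly_op (q n) T) \<longlonglongrightarrow> cfc f T"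
  using polynomial_approximation[OF assms] cfc_tendsto[OF T] by blast

lemma self_adjoint_cfc:
  assumes "continuous_on {a..b} f"
  shows "self_adjoint (cfc f T)"
proof -
  obtain q where "(\<lambda>n. poly_op (q n) T) \<longlonglongrightarrow> cfc f T" by (rule cfc_approximation[OF assms])
  thus ?thesis using self_adjoint_limit self_adjoint_poly_op T by (metis op_between_def)
qed

lemma cfc_cong: 
  assumes "\<And>r. r \<in> {a..b} \<Longrightarrow> f r = g r" "continuous_on {a..b} f"
  shows "cfc f T = cfc g T"
proof -
  obtain q where q: "uniform_limit {a..b} (\<lambda>n. poly (q n)) f sequentially" "(\<lambda>n. poly_op (q n) T) \<longlonglongrightarrow> cfc f T"
    by (rule cfc_approximation[OF assms(2)])
  have "uniform_limit {a..b} (\<lambda>n. poly (q n)) g sequentially"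
    using q(1) assms(1) uniform_limit_cong'[of "{a..b}" "\<lambda>n. poly (q n)" "\<lambda>n. poly (q n)" f g] by blast
  thus ?thesis using cfc_tendsto[OF T] LIMSEQ_unique q(2) by blast
qed

lemma cfc_add:
  assumes "continuous_on {a..b} f" "continuous_on {a..b} g"
  shows "cfc (\<lambda>r. f r + g r) T = cfc f T + cfc g T"
proof -
  obtain p where p: "uniform_limit {a..b} (\<lambda>n. poly (p n)) f sequentially" "(\<lambda>n. poly_op (p n) T) \<longlonglongrightarrow> cfc f T"
    by (rule cfc_approximation[OF assms(1)])
  obtain q where q: "uniform_limit {a..b} (\<lambda>n. poly (q n)) g sequentially" "(\<lambda>n. poly_op (q n) T) \<longlonglongrightarrow> cfc g T"
    by (rule cfc_approximation[OF assms(2)])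
  have "uniform_limit {a..b} (\<lambda>n. poly (p n + q n)) (\<lambda>r. f r + g r) sequentially"
    using uniform_limit_add[OF p(1) q(1)] by (simp add: poly_add[abs_def])
  from cfc_tendsto[OF T this] show ?thesis
    using LIMSEQ_unique tendsto_add[OF p(2) q(2)] by (simp add: poly_op_add)
qed

lemma cfc_mult:
  assumes "continuous_on {a..b} f" "continuous_on {a..b} g"
  shows "cfc (\<lambda>r. f r * g r) T = cfc f T o\<^sub>L cfc g T"
proof -
  obtain p where p: "uniform_limit {a..b} (\<lambda>n. poly (p n)) f sequentially" "(\<lambda>n. poly_op (p n) T) \<longlonglongrightarrow> cfc f T"
    by (rule cfc_approximation[OF assms(1)])
  obtain q where q: "uniform_limit {a..b} (\<lambda>n. poly (q n)) g sequentially" "(\<lambda>n. poly_op (q n) T) \<longlonglongrightarrow> cfc g T"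
    by (rule cfc_approximation[OF assms(2)])
  \<comment> \<open>Products of uniform limits are uniform limits only under boundedness, supplied
    here by compactness of the interval.\<close>
  have "bounded (f ` {a..b})" "bounded (g ` {a..b})"
    using assms by (simp_all add: compact_continuous_image compact_imp_bounded)
  from uniform_lim_mult[OF p(1) q(1) this]
  have "uniform_limit {a..b} (\<lambda>n. poly (p n * q n)) (\<lambda>r. f r * g r) sequentially"
    by (simp add: poly_mult[abs_def])
  from cfc_tendsto[OF T this] show ?thesis
    using LIMSEQ_unique bounded_bilinear.tendsto[OF bounded_bilinear_blinfun_compose p(2) q(2)]
    by (simp add: poly_op_mult)
qed

lemma cfc_const: "cfc (\<lambda>_. c) T = c *\<^sub>R id_blinfun"
proof -
  have "poly [:c:] = (\<lambda>_. c)" by auto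
  thus ?thesis using cfc_poly[OF T, of "[:c:]"] by (simp add: poly_op_pCons)
qed

lemma cfc_id: "cfc (\<lambda>r. r) T = T"
proof -
  have "poly [:0, 1:] = (\<lambda>r :: real. r)" by auto
  moreover have "poly_op [:0, 1:] T = T" by (intro blinfun_eqI) (simp add: poly_op_pCons blinfun.bilinear_simps)
  ultimately show ?thesis using cfc_poly[OF T, of "[:0, 1:]"] by simp
qed

lemma cfc_cmult: "continuous_on {a..b} f \<Longrightarrow> cfc (\<lambda>r. c * f r) T = c *\<^sub>R cfc f T"
  using cfc_mult[of "\<lambda>_. c" f] by (simp add: cfc_const) (intro blinfun_eqI, simp add: blinfun.bilinear_simps)

text \<open>Polynomials approximating the nonnegative function g - f may dip below zero, but
  eventually by less than any given d, which costs at most d |v|^2 in the expectation.\<close>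

lemma cfc_mono:
  assumes f: "continuous_on {a..b} f" and g: "continuous_on {a..b} g"
    and le: "\<And>r. r \<in> {a..b} \<Longrightarrow> f r \<le> g r"
  shows "expect (cfc f T) v \<le> expect (cfc g T) v"
proof -
  \<comment> \<open>The difference is written as \<open>g r + - 1 * f r\<close> to match
    \<open>cfc_add\<close> and \<open>cfc_cmult\<close>.\<close>
  have ch: "continuous_on {a..b} (\<lambda>r. g r + - 1 * f r)" using f g by (intro continuous_intros)
  obtain q where q: "uniform_limit {a..b} (\<lambda>n. poly (q n)) (\<lambda>r. g r + - 1 * f r) sequentially"
      "(\<lambda>n. poly_op (q n) T) \<longlonglongrightarrow> cfc (\<lambda>r. g r + - 1 * f r) T"
    by (rule cfc_approximation[OF ch])
  have sa: "self_adjoint T" using T by (simp add: op_between_def)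
  have "- e \<le> expect (cfc (\<lambda>r. g r + - 1 * f r) T) v" if e: "e > 0" for e
  proof (rule tendsto_lowerbound[OF tendsto_expect[OF q(2)]])
    define d where "d = e / ((norm v)\<^sup>2 + 1)"
    have d: "d > 0" "d * (norm v)\<^sup>2 \<le> e"
      unfolding d_def using e zero_le_power2[of "norm v"]
      by (simp_all add: add_nonneg_pos pos_divide_le_eq mult_left_mono)
    show "\<forall>\<^sub>F n in sequentially. - e \<le> expect (poly_op (q n) T) v"
      using uniform_limitD[OF q(1) d(1)]
    proof eventually_elim
      case (elim n)
      have "- d * (norm v)\<^sup>2 \<le> expect (poly_op (q n) T) v"
      proof (rule poly_op_ge[OF sa])
        fix r assume "r \<in> real_spectrum T"
        hence r: "r \<in> {a..b}" using real_spectrum_between[OF T] by blast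
        show "- d \<le> poly (q n) r" using bspec[OF elim r] le[OF r] by (simp add: dist_real_def)
      qed
      thus ?case using d(2) by simp
    qed
  qed simp
  hence "0 \<le> expect (cfc (\<lambda>r. g r + - 1 * f r) T) v"
    using field_le_epsilon[of "- expect (cfc (\<lambda>r. g r + - 1 * f r) T) v" 0] by fastforce
  also have "cfc (\<lambda>r. g r + - 1 * f r) T = cfc g T + - 1 *\<^sub>R cfc f T"
    using f g by (subst cfc_add, simp, intro continuous_intros, simp) (simp only: cfc_cmult)
  finally show ?thesis by (simp add: expect_add expect_diff)
qed

lemma op_between_cfc:
  assumes f: "continuous_on {a..b} f" and cd: "\<And>r. r \<in> {a..b} \<Longrightarrow> f r \<in> {c..d}"
  shows "op_between (cfc f T) c d"
proof -
  have "c * (norm v)\<^sup>2 \<le> expect (cfc f T) v" for v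
    using cfc_mono[of "\<lambda>_. c" f v] f cd by (simp add: cfc_const expect_scaleR expect_id)
  moreover have "expect (cfc f T) v \<le> d * (norm v)\<^sup>2" for v
    using cfc_mono[of f "\<lambda>_. d" v] f cd by (simp add: cfc_const expect_scaleR expect_id)
  ultimately show ?thesis using self_adjoint_cfc[OF f] by (simp add: op_between_def)
qed

lemma poly_op_cfc:
  assumes f: "continuous_on {a..b} f"
  shows "poly_op q (cfc f T) = cfc (\<lambda>r. poly q (f r)) T"
proof (induction q)
  case 0
  show ?case by (simp add: cfc_const)
next
  case (pCons c q)
  have "continuous_on {a..b} (\<lambda>r. poly q (f r))" using f by (intro continuous_intros)
  hence "cfc (\<lambda>r. c + f r * poly q (f r)) T = c *\<^sub>R id_blinfun + (cfc f T o\<^sub>L cfc (\<lambda>r. poly q (f r)) T)"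
    using f by (subst cfc_add) (auto simp: cfc_mult cfc_const intro!: continuous_intros)
  thus ?case using pCons by (simp add: poly_op_pCons)
qed

lemma norm_cfc_diff_le:
  assumes f: "continuous_on {a..b} f" and g: "continuous_on {a..b} g"
    and c: "\<And>r. r \<in> {a..b} \<Longrightarrow> \<bar>f r - g r\<bar> \<le> c" "0 \<le> c"
  shows "norm (cfc f T - cfc g T) \<le> c"
proof -
  obtain p where p: "uniform_limit {a..b} (\<lambda>n. poly (p n)) f sequentially" "(\<lambda>n. poly_op (p n) T) \<longlonglongrightarrow> cfc f T"
    by (rule cfc_approximation[OF f])
  obtain q where q: "uniform_limit {a..b} (\<lambda>n. poly (q n)) g sequentially" "(\<lambda>n. poly_op (q n) T) \<longlonglongrightarrow> cfc g T"
    by (rule cfc_approximation[OF g])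
  note sub = uniform_limit_on_subset[OF _ real_spectrum_between[OF T]]
  show ?thesis
    using T c real_spectrum_between[OF T]
    by (intro norm_poly_op_limit_le[OF _ sub[OF p(1)] p(2) sub[OF q(1)] q(2)]) (auto simp: op_between_def)
qed

lemma tendsto_cfc:
  assumes f: "\<And>n. continuous_on {a..b} (f n)" and g: "continuous_on {a..b} g"
    and lim: "uniform_limit {a..b} f g F"
  shows "((\<lambda>n. cfc (f n) T) \<longlongrightarrow> cfc g T) F"
proof (rule tendstoI)
  fix e :: real assume e: "e > 0"
  show "\<forall>\<^sub>F n in F. dist (cfc (f n) T) (cfc g T) < e"
    using uniform_limitD[OF lim half_gt_zero[OF e]]
  proof eventually_elim
    case (elim n)
    have "norm (cfc (f n) T - cfc g T) \<le> e / 2"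
      using elim e by (intro norm_cfc_diff_le f g) (auto simp: dist_real_def less_imp_le)
    thus ?case using e by (simp add: dist_norm)
  qed
qed

text \<open>For polynomial g this is \<open>poly_op_cfc\<close>; in general both sides are limits of
  q_n(f(T)) for polynomials q_n converging to g.\<close>

lemma cfc_cfc:
  assumes f: "continuous_on {a..b} f" and cd: "\<And>r. r \<in> {a..b} \<Longrightarrow> f r \<in> {c..d}"
    and g: "continuous_on {c..d} g"
  shows "cfc g (cfc f T) = cfc (\<lambda>r. g (f r)) T"
proof -
  obtain q where q: "uniform_limit {c..d} (\<lambda>n. poly (q n)) g sequentially"
    using polynomial_approximation[OF g] by blast
  have "(\<lambda>n. poly_op (q n) (cfc f T)) \<longlonglongrightarrow> cfc g (cfc f T)"
    by (rule cfc_tendsto[OF op_between_cfc[OF f cd] q])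
  moreover have "(\<lambda>n. cfc (\<lambda>r. poly (q n) (f r)) T) \<longlonglongrightarrow> cfc (\<lambda>r. g (f r)) T"
  proof (rule tendsto_cfc)
    show "continuous_on {a..b} (\<lambda>r. poly (q n) (f r))" for n using f by (intro continuous_intros)
    show "continuous_on {a..b} (\<lambda>r. g (f r))"
      by (rule continuous_on_compose2[OF g f]) (use cd in blast)
    show "uniform_limit {a..b} (\<lambda>n r. poly (q n) (f r)) (\<lambda>r. g (f r)) sequentially"
      by (rule uniform_limit_compose'[OF q]) (auto intro: cd simp del: atLeastAtMost_iff)
  qed
  ultimately show ?thesis unfolding poly_op_cfc[OF f] by (rule LIMSEQ_unique)
qed

end

subsection \<open>Superquadraticity of powers\<close>

text \<open>Factor z^q = z z^(q-1) and enlarge both bases in the second factor to x + y.\<close>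

lemma powr_superadditive:
  fixes x y q :: real
  assumes "0 \<le> x" "0 \<le> y" "1 \<le> q"
  shows "x powr q + y powr q \<le> (x + y) powr q"
proof -
  have split: "z powr q = z * z powr (q - 1)" if "0 \<le> z" for z :: real
    using that by (cases "z = 0") (auto simp: powr_diff)
  have "x powr q + y powr q = x * x powr (q - 1) + y * y powr (q - 1)" using assms by (simp add: split)
  also have "\<dots> \<le> x * (x + y) powr (q - 1) + y * (x + y) powr (q - 1)"
    using assms by (intro add_mono mult_left_mono powr_mono2) auto
  also have "\<dots> = (x + y) powr q" using assms by (simp add: split[of "x + y"] distrib_right)
  finally show ?thesis .
qed

text \<open>The right side minus the left side vanishes at a = c. As a function of a its derivative
  has the sign of a - c, by superadditivity of the power p - 1; this is where p \<ge> 2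
  enters.\<close>

lemma powr_superquadratic:
  fixes a c p :: real
  assumes "0 \<le> a" "0 \<le> c" "2 \<le> p"
  shows "c powr p + p * c powr (p - 1) * (a - c) + \<bar>a - c\<bar> powr p \<le> a powr p"
proof (cases "c \<le> a")
  case True
  define f where "f z = z powr p - c powr p - p * c powr (p - 1) * (z - c) - (z - c) powr p" for z
  have "f c \<le> f a"
  proof (rule DERIV_nonneg_imp_increasing_open[OF True])
    fix z assume z: "c < z" "z < a"
    have "(f has_real_derivative p * z powr (p - 1) - p * c powr (p - 1) - p * (z - c) powr (p - 1)) (at z)"
      unfolding f_def using z assms by (auto intro!: derivative_eq_intros)
    moreover have "c powr (p - 1) + (z - c) powr (p - 1) \<le> z powr (p - 1)"
      using powr_superadditive[of c "z - c" "p - 1"] z assms by simp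
    hence "0 \<le> p * (z powr (p - 1) - c powr (p - 1) - (z - c) powr (p - 1))"
      using assms by simp
    ultimately show "\<exists>y. (f has_real_derivative y) (at z) \<and> 0 \<le> y" by (auto simp: right_diff_distrib)
  next
    show "continuous_on {c..a} f"
      unfolding f_def using assms by (auto intro!: continuous_intros continuous_on_powr')
  qed
  thus ?thesis using True by (simp add: f_def)
next
  case False
  define f where "f z = z powr p - c powr p - p * c powr (p - 1) * (z - c) - (c - z) powr p" for z
  have "f c \<le> f a"
  proof (rule DERIV_nonpos_imp_decreasing_open[where a = a and b = c])
    show "a \<le> c" using False by simp
    fix z assume z: "a < z" "z < c"
    have "(f has_real_derivative p * z powr (p - 1) - p * c powr (p - 1) + p * (c - z) powr (p - 1)) (at z)"
      unfolding f_def using z assms by (auto intro!: derivative_eq_intros)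
    moreover have "z powr (p - 1) + (c - z) powr (p - 1) \<le> c powr (p - 1)"
      using powr_superadditive[of z "c - z" "p - 1"] z assms by simp
    hence "0 \<le> p * (c powr (p - 1) - z powr (p - 1) - (c - z) powr (p - 1))"
      using assms by simp
    ultimately show "\<exists>y. (f has_real_derivative y) (at z) \<and> y \<le> 0" by (force simp: right_diff_distrib)
  next
    show "continuous_on {a..c} f"
      unfolding f_def using assms by (auto intro!: continuous_intros continuous_on_powr')
  qed
  thus ?thesis using False by (simp add: f_def)
qed

lemma abs_diff_powr_le:
  fixes a c p :: real
  assumes "0 \<le> a" "0 \<le> c" "0 \<le> p"
  shows "\<bar>a - c\<bar> powr p \<le> a powr p + c powr p"
proof (cases "c \<le> a")
  case True
  hence "\<bar>a - c\<bar> powr p \<le> a powr p" using assms by (intro powr_mono2) auto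
  thus ?thesis by (simp add: add_increasing2)
next
  case False
  hence "\<bar>a - c\<bar> powr p \<le> c powr p" using assms by (intro powr_mono2) auto
  thus ?thesis by (simp add: add_increasing)
qed

subsection \<open>Powers of positive operators\<close>

lemma continuous_on_abs_powr:
  fixes f :: "real \<Rightarrow> real"
  assumes "continuous_on S f" "0 < p"
  shows "continuous_on S (\<lambda>r. \<bar>f r\<bar> powr p)"
  using assms by (intro continuous_on_powr') (auto intro!: continuous_intros)

context
  fixes A :: "'h::complex_hilbert_space \<Rightarrow>\<^sub>L 'h" and p :: real
  assumes A: "A \<in> positive_ops" and p: "2 \<le> p"
begin

lemma continuous_on_powr_nonneg: "continuous_on {0..b} (\<lambda>r. r powr p)"
  using p by (intro continuous_on_powr') (auto intro!: continuous_intros)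

text \<open>Collapses the nested calculi (square, square root, power p) into a single function of
  \<open>A\<close>, so that scalar inequalities can be read off on
  \<open>{0..norm A}\<close>.\<close>

lemma op_powr_op_abs_affine:
  "op_powr (op_abs (s *\<^sub>R A - c *\<^sub>R id_blinfun)) p = cfc (\<lambda>r. \<bar>s * r - c\<bar> powr p) A"
proof -
  note btw = positive_ops_between[OF A]
  define K where "K = norm A"
  \<comment> \<open>A bound for |s r - c| on the spectral interval; it provides the intervals
    [0, L^2] and [0, L] on which the outer functions must be continuous.\<close>
  define L where "L = \<bar>s\<bar> * K + \<bar>c\<bar>"
  note btw' = btw[folded K_def]
  have lin: "continuous_on {0..K} (\<lambda>r. s * r - c)" by (intro continuous_intros)
  have L: "\<bar>s * r - c\<bar> \<le> L" if "r \<in> {0..K}" for r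
  proof -
    have "\<bar>s * r - c\<bar> \<le> \<bar>s\<bar> * \<bar>r\<bar> + \<bar>c\<bar>" using abs_triangle_ineq4[of "s * r" c] by (simp add: abs_mult)
    also have "\<dots> \<le> L" unfolding L_def using that by (intro add_right_mono mult_left_mono) auto
    finally show ?thesis .
  qed
  have T: "s *\<^sub>R A - c *\<^sub>R id_blinfun = cfc (\<lambda>r. s * r - c) A"
    using cfc_add[OF btw', of "\<lambda>r. s * r" "\<lambda>_. - c"] cfc_cmult[OF btw', of "\<lambda>r. r" s]
    by (simp add: cfc_id[OF btw'] cfc_const[OF btw'] continuous_intros)
  have "cfc (\<lambda>r. s * r - c) A o\<^sub>L cfc (\<lambda>r. s * r - c) A = cfc (\<lambda>r. (s * r - c) * (s * r - c)) A"
    by (rule cfc_mult[OF btw' lin lin, symmetric])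
  hence "op_abs (s *\<^sub>R A - c *\<^sub>R id_blinfun)
      = cfc (\<lambda>r. r powr (1 / 2)) (cfc (\<lambda>r. (s * r - c) * (s * r - c)) A)"
    unfolding op_abs_def op_powr_def T by simp
  also have "\<dots> = cfc (\<lambda>r. ((s * r - c) * (s * r - c)) powr (1 / 2)) A"
  proof (rule cfc_cfc[OF btw', where c = 0 and d = "L * L"])
    show "continuous_on {0..K} (\<lambda>r. (s * r - c) * (s * r - c))" by (intro continuous_intros)
    show "continuous_on {0..L * L} (\<lambda>r. r powr (1 / 2))"
      by (intro continuous_on_powr') (auto intro!: continuous_intros)
    fix r assume "r \<in> {0..K}"
    from mult_mono[OF L[OF this] L[OF this]] L[OF this]
    show "(s * r - c) * (s * r - c) \<in> {0..L * L}" by (simp add: abs_mult_self_eq)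
  qed
  also have "\<dots> = cfc (\<lambda>r. \<bar>s * r - c\<bar>) A"
    by (simp add: powr_half_sqrt)
  finally have abs: "op_abs (s *\<^sub>R A - c *\<^sub>R id_blinfun) = cfc (\<lambda>r. \<bar>s * r - c\<bar>) A" .
  show ?thesis
    unfolding abs unfolding op_powr_def
  proof (rule cfc_cfc[OF btw', where c = 0 and d = L])
    show "continuous_on {0..K} (\<lambda>r. \<bar>s * r - c\<bar>)" by (intro continuous_intros)
    show "continuous_on {0..L} (\<lambda>r. r powr p)" by (rule continuous_on_powr_nonneg)
  qed (use L in auto)
qed

lemma continuous_affine_powr: "continuous_on S (\<lambda>r. \<bar>s * r - c\<bar> powr p)"
  using p by (intro continuous_on_abs_powr continuous_intros) auto

lemma op_powr_positive: "op_powr A p \<in> positive_ops"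
proof (rule op_between_positive)
  show "op_between (op_powr A p) 0 (norm A powr p)"
    unfolding op_powr_def using p
    by (intro op_between_cfc[OF positive_ops_between[OF A]] continuous_on_powr_nonneg) (auto intro: powr_mono2)
qed

text \<open>From r \<le> 1 + r^p. This is how integrability of F^p yields local integrability of
  F.\<close>

lemma expect_le_op_powr: "expect A v \<le> (norm v)\<^sup>2 + expect (op_powr A p) v"
proof -
  note btw = positive_ops_between[OF A]
  have "expect (cfc (\<lambda>r. r) A) v \<le> expect (cfc (\<lambda>r. 1 + r powr p) A) v"
  proof (rule cfc_mono[OF btw])
    fix r assume r: "r \<in> {0..norm A}"
    show "r \<le> 1 + r powr p"
    proof (cases "r \<le> 1")
      case False
      hence "r powr 1 \<le> r powr p" using p by (intro powr_mono) auto
      thus ?thesis using False by simp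
    qed (simp add: add_increasing2)
  qed (use p in \<open>auto intro!: continuous_intros continuous_on_powr_nonneg\<close>)
  also have "cfc (\<lambda>r. 1 + r powr p) A = 1 *\<^sub>R id_blinfun + op_powr A p"
    unfolding op_powr_def
    by (subst cfc_add[OF btw]) (auto simp: cfc_const[OF btw] intro!: continuous_intros continuous_on_powr_nonneg)
  finally show ?thesis by (simp add: cfc_id[OF btw] expect_add expect_id)
qed

lemma op_powr_op_abs_affine_positive:
  "op_powr (op_abs (s *\<^sub>R A - c *\<^sub>R id_blinfun)) p \<in> positive_ops"
proof -
  have "bounded ((\<lambda>r. \<bar>s * r - c\<bar> powr p) ` {0..norm A})"
    by (intro compact_imp_bounded compact_continuous_image continuous_affine_powr compact_Icc)
  then obtain B where "\<forall>r\<in>{0..norm A}. \<bar>s * r - c\<bar> powr p \<le> B" by (auto simp: bounded_iff)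
  hence "op_between (op_powr (op_abs (s *\<^sub>R A - c *\<^sub>R id_blinfun)) p) 0 B"
    unfolding op_powr_op_abs_affine
    by (intro op_between_cfc[OF positive_ops_between[OF A]] continuous_affine_powr) auto
  thus ?thesis by (rule op_between_positive)
qed

lemma expect_op_powr_scale:
  assumes "0 \<le> s"
  shows "expect (cfc (\<lambda>r. (s * r) powr p) A) v = s powr p * expect (op_powr A p) v"
proof -
  note btw = positive_ops_between[OF A]
  have "cfc (\<lambda>r. s powr p * r powr p) A = cfc (\<lambda>r. (s * r) powr p) A"
    using assms by (intro cfc_cong[OF btw]) (auto simp: powr_mult intro!: continuous_intros continuous_on_powr_nonneg)
  thus ?thesis using cfc_cmult[OF btw continuous_on_powr_nonneg, of "s powr p"]
    unfolding op_powr_def by (metis expect_scaleR)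
qed

text \<open>The scalar inequality \<open>powr_superquadratic\<close> at a = s r, with its affine
  part moved to the other side after taking expectations.\<close>

lemma expect_op_powr_op_abs_affine_le:
  assumes "0 \<le> s" "0 \<le> c"
  shows "expect (op_powr (op_abs (s *\<^sub>R A - c *\<^sub>R id_blinfun)) p) v
    \<le> s powr p * expect (op_powr A p) v - c powr p * (norm v)\<^sup>2
      - p * c powr (p - 1) * (s * expect A v - c * (norm v)\<^sup>2)"
proof -
  note btw = positive_ops_between[OF A]
  define l where "l = p * c powr (p - 1)"
  have cl: "continuous_on {0..norm A} (\<lambda>r. l * s * r + (c powr p - l * c))" by (intro continuous_intros)
  have cp: "continuous_on {0..norm A} (\<lambda>r. (s * r) powr p)"
    using assms p by (intro continuous_on_powr') (auto intro!: continuous_intros)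
  have "expect (cfc (\<lambda>r. \<bar>s * r - c\<bar> powr p + (l * s * r + (c powr p - l * c))) A) v
      \<le> expect (cfc (\<lambda>r. (s * r) powr p) A) v"
  proof (rule cfc_mono[OF btw _ cp])
    fix r assume "r \<in> {0..norm A}"
    thus "\<bar>s * r - c\<bar> powr p + (l * s * r + (c powr p - l * c)) \<le> (s * r) powr p"
      using powr_superquadratic[of "s * r" c p] assms p by (simp add: l_def algebra_simps)
  qed (intro continuous_on_add continuous_affine_powr cl)
  also have "cfc (\<lambda>r. \<bar>s * r - c\<bar> powr p + (l * s * r + (c powr p - l * c))) A
      = op_powr (op_abs (s *\<^sub>R A - c *\<^sub>R id_blinfun)) p + ((l * s) *\<^sub>R A + (c powr p - l * c) *\<^sub>R id_blinfun)"
    unfolding op_powr_op_abs_affine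
    using cfc_add[OF btw continuous_affine_powr cl, of s c]
      cfc_add[OF btw, of "\<lambda>r. l * s * r" "\<lambda>_. c powr p - l * c"] cfc_cmult[OF btw, of "\<lambda>r. r" "l * s"]
    by (simp add: cfc_id[OF btw] cfc_const[OF btw] continuous_intros)
  finally show ?thesis
    using expect_op_powr_scale[OF assms(1), of v]
    by (simp only: expect_add expect_scaleR expect_id) (simp add: l_def algebra_simps)
qed

text \<open>Meant for arbitrary vectors v: the constant c(x) is adapted to \<eta>, so for other
  vectors the linear term of the sharp bound does not combine with the rest.\<close>

lemma expect_op_powr_op_abs_affine_crude:
  assumes "0 \<le> s" "0 \<le> c"
  shows "expect (op_powr (op_abs (s *\<^sub>R A - c *\<^sub>R id_blinfun)) p) v
    \<le> s powr p * expect (op_powr A p) v + c powr p * (norm v)\<^sup>2"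
proof -
  note btw = positive_ops_between[OF A]
  have cp: "continuous_on {0..norm A} (\<lambda>r. (s * r) powr p)"
    using assms p by (intro continuous_on_powr') (auto intro!: continuous_intros)
  have "expect (cfc (\<lambda>r. \<bar>s * r - c\<bar> powr p) A) v \<le> expect (cfc (\<lambda>r. (s * r) powr p + c powr p) A) v"
    using assms p abs_diff_powr_le
    by (intro cfc_mono[OF btw] continuous_affine_powr continuous_on_add cp continuous_on_const) auto
  also have "cfc (\<lambda>r. (s * r) powr p + c powr p) A = cfc (\<lambda>r. (s * r) powr p) A + (c powr p) *\<^sub>R id_blinfun"
    by (subst cfc_add[OF btw cp]) (auto simp: cfc_const[OF btw])
  finally show ?thesis
    using expect_op_powr_scale[OF assms(1), of v]
    by (simp add: op_powr_op_abs_affine expect_add expect_scaleR expect_id)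
qed

lemma tendsto_expect_op_powr_op_abs_affine:
  assumes s: "(s \<longlongrightarrow> s0) G" and c: "(c \<longlongrightarrow> c0) G"
  shows "((\<lambda>n. expect (op_powr (op_abs (s n *\<^sub>R A - c n *\<^sub>R id_blinfun)) p) v)
    \<longlongrightarrow> expect (op_powr (op_abs (s0 *\<^sub>R A - c0 *\<^sub>R id_blinfun)) p) v) G"
  unfolding op_powr_op_abs_affine
proof (rule tendsto_expect, rule tendsto_cfc[OF positive_ops_between[OF A]])
  show "continuous_on {0..norm A} (\<lambda>r. \<bar>s n * r - c n\<bar> powr p)" for n by (rule continuous_affine_powr)
  show "continuous_on {0..norm A} (\<lambda>r. \<bar>s0 * r - c0\<bar> powr p)" by (rule continuous_affine_powr)
  \<comment> \<open>Room for a deviation of less than 1 from the limit function, which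
    \<open>lim\<close> grants eventually; uniform continuity of the outer power is then only needed
    on a compact interval.\<close>
  define L where "L = (\<bar>s0\<bar> + 1) * norm A + (\<bar>c0\<bar> + 1)"
  have "((\<lambda>n. \<bar>s n - s0\<bar> * norm A + \<bar>c n - c0\<bar>) \<longlongrightarrow> \<bar>s0 - s0\<bar> * norm A + \<bar>c0 - c0\<bar>) G"
    using s c by (intro tendsto_intros)
  hence lim: "((\<lambda>n. \<bar>s n - s0\<bar> * norm A + \<bar>c n - c0\<bar>) \<longlongrightarrow> 0) G" by simp
  have diff: "\<bar>(s n * r - c n) - (s0 * r - c0)\<bar> \<le> \<bar>s n - s0\<bar> * norm A + \<bar>c n - c0\<bar>" if "r \<in> {0..norm A}" for r n
  proof -
    have "\<bar>(s n * r - c n) - (s0 * r - c0)\<bar> = \<bar>(s n - s0) * r - (c n - c0)\<bar>" by (simp add: algebra_simps)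
    also have "\<dots> \<le> \<bar>s n - s0\<bar> * \<bar>r\<bar> + \<bar>c n - c0\<bar>" using abs_triangle_ineq4 by (metis abs_mult)
    also have "\<dots> \<le> \<bar>s n - s0\<bar> * norm A + \<bar>c n - c0\<bar>" using that by (intro add_right_mono mult_left_mono) auto
    finally show ?thesis .
  qed
  have B0: "\<bar>s0 * r - c0\<bar> \<le> \<bar>s0\<bar> * norm A + \<bar>c0\<bar>" if "r \<in> {0..norm A}" for r
  proof -
    have "\<bar>s0 * r - c0\<bar> \<le> \<bar>s0\<bar> * \<bar>r\<bar> + \<bar>c0\<bar>" using abs_triangle_ineq4 by (metis abs_mult)
    also have "\<dots> \<le> \<bar>s0\<bar> * norm A + \<bar>c0\<bar>" using that by (intro add_right_mono mult_left_mono) auto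
    finally show ?thesis .
  qed
  show "uniform_limit {0..norm A} (\<lambda>n r. \<bar>s n * r - c n\<bar> powr p) (\<lambda>r. \<bar>s0 * r - c0\<bar> powr p) G"
  proof (rule uniform_limit_compose_uniformly_continuous_on[where f = "\<lambda>r. \<bar>r\<bar> powr p" and B = "{- L..L}"])
    show "uniform_limit {0..norm A} (\<lambda>n r. s n * r - c n) (\<lambda>r. s0 * r - c0) G"
    proof (rule uniform_limitI)
      fix e :: real assume "e > 0"
      from order_tendstoD(2)[OF lim this]
      show "\<forall>\<^sub>F n in G. \<forall>r\<in>{0..norm A}. dist (s n * r - c n) (s0 * r - c0) < e"
        by eventually_elim (use diff in \<open>fastforce simp: dist_real_def intro: le_less_trans\<close>)
    qed
    show "uniformly_continuous_on {- L..L} (\<lambda>r. \<bar>r\<bar> powr p)"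
      using p by (intro compact_uniformly_continuous continuous_on_abs_powr continuous_intros compact_Icc) auto
    show "\<forall>\<^sub>F n in G. \<forall>r\<in>{0..norm A}. s n * r - c n \<in> {- L..L}"
      using order_tendstoD(2)[OF lim zero_less_one]
    proof eventually_elim
      case (elim n)
      show ?case
      proof
        fix r assume r: "r \<in> {0..norm A}"
        show "s n * r - c n \<in> {- L..L}"
          using diff[OF r, of n] B0[OF r] elim norm_ge_zero[of A] unfolding L_def atLeastAtMost_iff distrib_right by linarith
      qed
    qed
  qed simp
qed

end

subsection \<open>Integrals over half-lines and intervals\<close>

lemma sigma_finite_lebesgue_on:
  assumes "S \<in> sets lebesgue"
  shows "sigma_finite_measure (lebesgue_on S)"
proof (rule sigma_finite_measure_restrict_space[OF _ assms])
  obtain C :: "'a set set" where C: "countable C" "C \<subseteq> sets lborel" "\<Union> C = space lborel"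
      "\<forall>a\<in>C. emeasure lborel a \<noteq> \<infinity>"
    using lborel.sigma_finite_countable by blast
  show "sigma_finite_measure (lebesgue :: 'a measure)"
    by standard (use C in \<open>auto intro!: exI[of _ C] simp: subset_eq\<close>)
qed

text \<open>Variable intervals become indicator cut-offs on one fixed measure space, as Fubini and
  dominated convergence require.\<close>

lemma lebesgue_on_Ioo:
  "lebesgue_on {0<..<x} = restrict_space (lebesgue_on {0<..}) {..<x}" for x :: real
proof -
  have "{0<..} \<inter> {..<x} = {0<..<x}" by auto
  thus ?thesis by (subst restrict_restrict_space) auto
qed

lemma Int_space_lebesgue_on: "{..<x} \<inter> space (lebesgue_on {0<..}) \<in> sets (lebesgue_on {0<..})" for x :: real
  by (auto simp: sets_restrict_space space_restrict_space)

lemma integrable_Ioo_iff: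
  fixes f :: "real \<Rightarrow> real"
  shows "integrable (lebesgue_on {0<..<x}) f \<longleftrightarrow> integrable (lebesgue_on {0<..}) (\<lambda>t. indicator {..<x} t * f t)"
  unfolding lebesgue_on_Ioo using integrable_restrict_space[OF Int_space_lebesgue_on, of x f] by simp

lemma integral_Ioo_eq:
  fixes f :: "real \<Rightarrow> real"
  shows "(LINT t|lebesgue_on {0<..<x}. f t) = (LINT t|lebesgue_on {0<..}. indicator {..<x} t * f t)"
  unfolding lebesgue_on_Ioo using integral_restrict_space[OF Int_space_lebesgue_on, of x f] by simp

lemma measurable_Ioo:
  fixes f :: "real \<Rightarrow> 'a::topological_space"
  assumes "f \<in> borel_measurable (lebesgue_on {0<..})"
  shows "f \<in> borel_measurable (lebesgue_on {0<..<x})"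
  unfolding lebesgue_on_Ioo using assms by (rule measurable_restrict_space1)

lemma measurable_Ioo_indicator:
  fixes f :: "real \<Rightarrow> real"
  assumes f: "f \<in> borel_measurable (lebesgue_on {0<..<x})"
  shows "(\<lambda>t. indicator {..<x} t * f t) \<in> borel_measurable (lebesgue_on {0<..})"
proof -
  have "(\<lambda>t. indicator {..<x} t *\<^sub>R f t) \<in> borel_measurable (lebesgue_on {0<..})"
    using f unfolding lebesgue_on_Ioo borel_measurable_restrict_space_iff[OF Int_space_lebesgue_on] .
  thus ?thesis by simp
qed

lemma borel_measurable_lebesgue_onI:
  fixes f :: "real \<Rightarrow> real"
  assumes "f \<in> borel_measurable borel"
  shows "f \<in> borel_measurable (lebesgue_on S)"
  using assms by (intro measurable_restrict_space1 measurable_completion) simp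

lemma integral_powr_Ioo:
  fixes a x :: real
  assumes "-1 < a" "0 < x"
  shows "integrable (lebesgue_on {0<..<x}) (\<lambda>t. t powr a)"
    and "(LINT t|lebesgue_on {0<..<x}. t powr a) = x powr (a + 1) / (a + 1)"
proof -
  have hi: "((\<lambda>t. t powr a) has_integral x powr (a + 1) / (a + 1)) {0<..<x}"
    using has_integral_powr_from_0[OF assms(1), of x] assms(2)
    using has_integral_open_interval[of "\<lambda>t. t powr a" _ 0 x] by simp
  have "(\<lambda>t. t powr a) absolutely_integrable_on {0<..<x}"
    by (rule nonnegative_absolutely_integrable_1) (use hi in \<open>auto simp: has_integral_iff\<close>)
  thus int: "integrable (lebesgue_on {0<..<x}) (\<lambda>t. t powr a)"
    by (rule absolutely_integrable_imp_integrable) auto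
  show "(LINT t|lebesgue_on {0<..<x}. t powr a) = x powr (a + 1) / (a + 1)"
    using lebesgue_integral_eq_integral[OF int] hi by (simp add: has_integral_iff)
qed

text \<open>The inner integral after the exchange of order, for the exponent a = 1/p - 2.\<close>

lemma nn_integral_powr_tail:
  fixes a t :: real
  assumes "a < -1" "0 < t"
  shows "(\<integral>\<^sup>+x. ennreal (indicator {t<..} x * x powr a) \<partial>lebesgue_on {0<..}) = ennreal (t powr (a + 1) / - (a + 1))"
proof -
  have hi: "((\<lambda>x. x powr a) has_integral t powr (a + 1) / - (a + 1)) {t..}"
    using has_integral_powr_to_inf[OF assms] by (metis minus_divide_left minus_divide_right)
  have "(\<integral>\<^sup>+x. ennreal (indicator {t<..} x * x powr a) \<partial>lebesgue_on {0<..})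
      = (\<integral>\<^sup>+x. ennreal (indicator {t<..} x * x powr a) * indicator {0<..} x \<partial>lebesgue)"
    by (subst nn_integral_restrict_space) auto
  also have "\<dots> = (\<integral>\<^sup>+x. ennreal (indicator {t<..} x * x powr a) * indicator {0<..} x \<partial>lborel)"
    by (simp add: nn_integral_completion)
  also have "\<dots> = (\<integral>\<^sup>+x. ennreal (indicator {t..} x * x powr a) \<partial>lborel)"
  proof (rule nn_integral_cong_AE)
    have "AE x in lborel. x \<noteq> t" by (rule AE_lborel_singleton)
    thus "AE x in lborel. ennreal (indicator {t<..} x * x powr a) * indicator {0<..} x = ennreal (indicator {t..} x * x powr a)"
      by eventually_elim (use assms in \<open>auto simp: indicator_def\<close>)
  qed
  also have "\<dots> = ennreal (t powr (a + 1) / - (a + 1))"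
    by (rule nn_integral_has_integral_lebesgue[OF _ hi]) simp
  finally show ?thesis .
qed

text \<open>By nonnegativity the integrals may be exchanged. The integral of x^(1/p - 2) over (t,
  \<infinity>) is t^(1/p - 1) / (1 - 1/p), which cancels the weight t^(1 - 1/p) and leaves p / (p -
  1).\<close>

lemma weighted_average_integral:
  fixes p :: real and g :: "real \<Rightarrow> real"
  assumes p: "1 < p" and g: "integrable (lebesgue_on {0<..}) g" and nonneg: "\<And>t. 0 < t \<Longrightarrow> 0 \<le> g t"
  defines "U \<equiv> (\<lambda>x. x powr (1 / p - 2) * (LINT t|lebesgue_on {0<..<x}. t powr (1 - 1 / p) * g t))"
  shows "\<And>x. 0 < x \<Longrightarrow> integrable (lebesgue_on {0<..<x}) (\<lambda>t. t powr (1 - 1 / p) * g t)"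
    and "integrable (lebesgue_on {0<..}) U"
    and "(LINT x|lebesgue_on {0<..}. U x) = p / (p - 1) * (LINT t|lebesgue_on {0<..}. g t)"
proof -
  let ?M = "lebesgue_on {0::real<..}"
  interpret M: sigma_finite_measure ?M by (rule sigma_finite_lebesgue_on) auto
  interpret MM: pair_sigma_finite ?M ?M ..
  have ip: "1 / p < 1" "0 < 1 / p" using p by (auto simp: field_simps)
  have gm: "g \<in> borel_measurable ?M" using g by auto
  have pm: "(\<lambda>t. t powr b) \<in> borel_measurable ?M" for b :: real
    by (rule borel_measurable_lebesgue_onI) measurable
  have idm: "(\<lambda>t. t) \<in> borel_measurable ?M"
    by (rule borel_measurable_lebesgue_onI) measurable
  show int: "integrable (lebesgue_on {0<..<x}) (\<lambda>t. t powr (1 - 1 / p) * g t)" if x: "0 < x" for x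
    unfolding integrable_Ioo_iff
  proof (rule Bochner_Integration.integrable_bound)
    show "integrable ?M (\<lambda>t. x powr (1 - 1 / p) * g t)" using g by simp
    show "(\<lambda>t. indicator {..<x} t * (t powr (1 - 1 / p) * g t)) \<in> borel_measurable ?M"
      by (intro measurable_Ioo_indicator measurable_Ioo borel_measurable_times pm gm)
    show "AE t in ?M. norm (indicator {..<x} t * (t powr (1 - 1 / p) * g t)) \<le> norm (x powr (1 - 1 / p) * g t)"
    proof (rule AE_I2)
      fix t assume "t \<in> space ?M"
      hence t: "t > 0" by simp
      have "t powr (1 - 1 / p) * g t \<le> x powr (1 - 1 / p) * g t" if "t < x"
        using that t ip nonneg[OF t] by (intro mult_right_mono powr_mono2) auto
      thus "norm (indicator {..<x} t * (t powr (1 - 1 / p) * g t)) \<le> norm (x powr (1 - 1 / p) * g t)"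
        using nonneg[OF t] by (auto simp: indicator_def)
    qed
  qed
  define k where "k x t = indicator {..<x} t * (x powr (1 / p - 2) * (t powr (1 - 1 / p) * g t))" for x t :: real
  have km: "case_prod k \<in> borel_measurable (?M \<Otimes>\<^sub>M ?M)"
  proof -
    note [measurable] = gm pm idm
    \<comment> \<open>The indicator depends on both variables; as a case distinction on
      \<open>snd z < fst z\<close> it is visibly jointly measurable.\<close>
    have "case_prod k = (\<lambda>z. if snd z < fst z then fst z powr (1 / p - 2) * (snd z powr (1 - 1 / p) * g (snd z)) else 0)"
      by (auto simp: k_def fun_eq_iff)
    also have "\<dots> \<in> borel_measurable (?M \<Otimes>\<^sub>M ?M)"
    proof (rule measurable_If)
      show "{z \<in> space (?M \<Otimes>\<^sub>M ?M). snd z < fst z} \<in> sets (?M \<Otimes>\<^sub>M ?M)"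
        by (rule borel_measurable_less) (use measurable_compose[OF measurable_snd idm] measurable_compose[OF measurable_fst idm] in auto)
      show "(\<lambda>z. fst z powr (1 / p - 2) * (snd z powr (1 - 1 / p) * g (snd z))) \<in> borel_measurable (?M \<Otimes>\<^sub>M ?M)"
        by (intro borel_measurable_times measurable_compose[OF measurable_fst pm]
            measurable_compose[OF measurable_snd pm] measurable_compose[OF measurable_snd gm])
    qed auto
    finally show ?thesis .
  qed
  have k_nonneg: "0 \<le> k x t" if "0 < t" for x t
    using nonneg[OF that] by (simp add: k_def)
  have kint: "integrable ?M (k x)" if "0 < x" for x
  proof -
    have "integrable ?M (\<lambda>t. x powr (1 / p - 2) * (indicator {..<x} t * (t powr (1 - 1 / p) * g t)))"
      using int[OF that] unfolding integrable_Ioo_iff by (rule integrable_mult_right)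
    thus ?thesis by (simp add: k_def[abs_def] mult_ac)
  qed
  have U: "U x = (LINT t|?M. k x t)" for x
    unfolding U_def integral_Ioo_eq k_def[abs_def] by (subst integral_mult_right_zero[symmetric]) (simp add: mult_ac)
  have Um: "U \<in> borel_measurable ?M"
    unfolding U[abs_def] by (rule M.borel_measurable_lebesgue_integral[OF km])
  have U_nonneg: "0 \<le> U x" for x
    unfolding U by (intro integral_nonneg_AE AE_I2 k_nonneg) simp
  have inner: "(\<integral>\<^sup>+x. ennreal (k x t) \<partial>?M) = ennreal (p / (p - 1) * g t)" if t: "0 < t" for t
  proof -
    have "(\<integral>\<^sup>+x. ennreal (k x t) \<partial>?M)
        = (\<integral>\<^sup>+x. ennreal (t powr (1 - 1 / p) * g t) * ennreal (indicator {t<..} x * x powr (1 / p - 2)) \<partial>?M)"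
      using nonneg[OF t] by (intro nn_integral_cong) (auto simp: k_def indicator_def ennreal_mult[symmetric] mult_ac)
    also have "\<dots> = ennreal (t powr (1 - 1 / p) * g t) * (\<integral>\<^sup>+x. ennreal (indicator {t<..} x * x powr (1 / p - 2)) \<partial>?M)"
      by (intro nn_integral_cmult measurable_compose[OF _ measurable_ennreal] borel_measurable_times pm
          borel_measurable_lebesgue_onI) auto
    also have "\<dots> = ennreal (t powr (1 - 1 / p) * g t) * ennreal (t powr (1 / p - 2 + 1) / - (1 / p - 2 + 1))"
      using ip t by (subst nn_integral_powr_tail) auto
    also have "\<dots> = ennreal ((t powr (1 - 1 / p) * t powr (1 / p - 1)) * (g t / (1 - 1 / p)))"
      using nonneg[OF t] ip by (subst ennreal_mult[symmetric]) (auto simp: field_simps)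
    also have "t powr (1 - 1 / p) * t powr (1 / p - 1) = 1" using t by (simp add: powr_add[symmetric])
    also have "1 * (g t / (1 - 1 / p)) = p / (p - 1) * g t" using p by (simp add: field_simps)
    finally show ?thesis .
  qed
  have "(\<integral>\<^sup>+x. ennreal (U x) \<partial>?M) = (\<integral>\<^sup>+x. (\<integral>\<^sup>+t. ennreal (k x t) \<partial>?M) \<partial>?M)"
    unfolding U by (intro nn_integral_cong nn_integral_eq_integral[symmetric] kint AE_I2) (auto simp: k_nonneg)
  also have "\<dots> = (\<integral>\<^sup>+t. (\<integral>\<^sup>+x. ennreal (k x t) \<partial>?M) \<partial>?M)"
    by (rule MM.Fubini'[symmetric]) (use measurable_compose[OF km measurable_ennreal] in \<open>simp add: case_prod_unfold\<close>)
  also have "\<dots> = (\<integral>\<^sup>+t. ennreal (p / (p - 1) * g t) \<partial>?M)"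
    by (intro nn_integral_cong inner) simp
  also have "\<dots> = ennreal (LINT t|?M. p / (p - 1) * g t)"
    using p g nonneg by (intro nn_integral_eq_integral AE_I2) auto
  \<comment> \<open>Used twice: finiteness gives integrability of \<open>U\<close>, and the value
    gives the last claim.\<close>
  finally have nn: "(\<integral>\<^sup>+x. ennreal (U x) \<partial>?M) = ennreal (p / (p - 1) * (LINT t|?M. g t))" by simp
  have c0: "0 \<le> p / (p - 1) * (LINT t|?M. g t)"
    using p nonneg by (intro mult_nonneg_nonneg integral_nonneg_AE AE_I2) auto
  show "integrable ?M U"
    by (rule integrableI_nonneg[OF Um]) (use nn U_nonneg in auto)
  show "(LINT x|?M. U x) = p / (p - 1) * (LINT t|?M. g t)"
    using nn c0 U_nonneg Um by (intro integral_eq_nn_integral[THEN trans]) auto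
qed

text \<open>Integrand and upper limit move together. With the limit encoded by an indicator,
  dominated convergence applies: pointwise convergence can fail only at t = x0, a null set.\<close>

lemma isCont_integral_Ioo:
  fixes k :: "real \<Rightarrow> real \<Rightarrow> real"
  assumes x0: "0 < x0"
    and meas: "\<And>x. x0 / 2 < x \<Longrightarrow> x < 2 * x0 \<Longrightarrow> k x \<in> borel_measurable (lebesgue_on {0<..<x})"
    and h: "integrable (lebesgue_on {0<..<2 * x0}) h"
    and bound: "\<And>x t. x0 / 2 < x \<Longrightarrow> x < 2 * x0 \<Longrightarrow> 0 < t \<Longrightarrow> t < x \<Longrightarrow> \<bar>k x t\<bar> \<le> h t"
    and cont: "\<And>t. 0 < t \<Longrightarrow> t < x0 \<Longrightarrow> isCont (\<lambda>x. k x t) x0"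
  shows "isCont (\<lambda>x. LINT t|lebesgue_on {0<..<x}. k x t) x0"
proof -
  let ?M = "lebesgue_on {0::real<..}"
  define S where "S = {x0 / 2<..<2 * x0}"
  have S: "open S" "x0 \<in> S" using x0 by (auto simp: S_def)
  have "continuous (at x0 within S) (\<lambda>x. LINT t|lebesgue_on {0<..<x}. k x t)"
  proof (rule continuous_within_sequentiallyI)
    fix u :: "nat \<Rightarrow> real" assume u: "u \<longlonglongrightarrow> x0" "\<forall>n. u n \<in> S"
    show "(\<lambda>n. LINT t|lebesgue_on {0<..<u n}. k (u n) t) \<longlonglongrightarrow> (LINT t|lebesgue_on {0<..<x0}. k x0 t)"
      unfolding integral_Ioo_eq
    proof (rule integral_dominated_convergence)
      show "(\<lambda>t. indicator {..<x0} t * k x0 t) \<in> borel_measurable ?M"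
        using S(2) by (intro measurable_Ioo_indicator meas) (auto simp: S_def)
      show "(\<lambda>t. indicator {..<u n} t * k (u n) t) \<in> borel_measurable ?M" for n
        using u(2) by (intro measurable_Ioo_indicator meas) (auto simp: S_def)
      show "integrable ?M (\<lambda>t. indicator {..<2 * x0} t * h t)" using h by (simp only: integrable_Ioo_iff)
      show "AE t in ?M. norm (indicator {..<u n} t * k (u n) t) \<le> indicator {..<2 * x0} t * h t" for n
      proof (rule AE_I2)
        fix t assume "t \<in> space ?M"
        hence t: "t > 0" by simp
        have un: "x0 / 2 < u n" "u n < 2 * x0" using u(2) by (auto simp: S_def)
        show "norm (indicator {..<u n} t * k (u n) t) \<le> indicator {..<2 * x0} t * h t"
        proof (cases "t < u n")
          case True
          thus ?thesis using bound[OF un t True] un by (simp add: indicator_def)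
        next
          case False
          have "0 \<le> h t" if "t < 2 * x0"
          proof -
            \<comment> \<open>Where the indicator vanishes the majorant must still be nonnegative;
              the assumed bound shows this at a parameter strictly between \<open>t\<close> and
              \<open>2 * x0\<close>.\<close>
            have "\<bar>k ((t + 2 * x0) / 2) t\<bar> \<le> h t"
              using \<open>t < 2 * x0\<close> t x0 by (intro bound) auto
            thus ?thesis using t x0 by auto
          qed
          thus ?thesis using False by (auto simp: indicator_def)
        qed
      qed
      have "AE t in lebesgue. t \<noteq> x0" using AE_lborel_singleton AE_completion by blast
      hence "AE t in ?M. t \<noteq> x0" by (subst AE_restrict_space_iff) auto
      moreover have "AE t in ?M. 0 < t" by (rule AE_I2) simp
      ultimately show "AE t in ?M. (\<lambda>n. indicator {..<u n} t * k (u n) t) \<longlonglongrightarrow> indicator {..<x0} t * k x0 t"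
      proof eventually_elim
        case (elim t)
        show ?case
        proof (cases "t < x0")
          case True
          have "(\<lambda>n. k (u n) t) \<longlonglongrightarrow> k x0 t"
            by (rule isCont_tendsto_compose[OF cont[OF elim(2) True] u(1)])
          moreover have "\<forall>\<^sub>F n in sequentially. t < u n" using order_tendstoD(1)[OF u(1) True] .
          hence "\<forall>\<^sub>F n in sequentially. k (u n) t = indicator {..<u n} t * k (u n) t"
            by eventually_elim simp
          ultimately show ?thesis using True by (simp add: tendsto_cong)
        next
          case False
          hence "x0 < t" using elim by simp
          hence "\<forall>\<^sub>F n in sequentially. u n < t" using order_tendstoD(2)[OF u(1)] by blast
          hence "\<forall>\<^sub>F n in sequentially. indicator {..<u n} t * k (u n) t = 0"
            by eventually_elim simp
          thus ?thesis using False by (simp add: tendsto_eventually)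
        qed
      qed
    qed
  qed
  thus ?thesis by (simp only: at_within_open[OF S(2,1)])
qed

subsection \<open>Weak integrals of positive operators\<close>

lemma has_weak_integral_unique:
  assumes "has_weak_integral G A S" "has_weak_integral G B S"
  shows "A = B"
proof (rule blinfun_eqI, rule cinner_ext)
  fix x y
  show "cinner (A x) y = cinner (B x) y"
    using assms has_bochner_integral_eq unfolding has_weak_integral_def by blast
qed

lemma weak_integral_eq: "has_weak_integral G A S \<Longrightarrow> weak_integral S G = A"
  unfolding weak_integral_def weakly_integrable_def using has_weak_integral_unique by (auto intro!: the_equality)

lemma has_weak_integral_weak_integral:
  "weakly_integrable S G \<Longrightarrow> has_weak_integral G (weak_integral S G) S"
  unfolding weakly_integrable_def using weak_integral_eq by blast

lemma has_weak_integral_expect: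
  assumes "has_weak_integral G A S"
  shows "integrable (lebesgue_on S) (\<lambda>t. expect (G t) v)"
    and "(LINT t|lebesgue_on S. expect (G t) v) = expect A v"
proof -
  have hb: "has_bochner_integral (lebesgue_on S) (\<lambda>t. cinner (G t v) v) (cinner (A v) v)"
    using assms by (simp add: has_weak_integral_def)
  hence i: "integrable (lebesgue_on S) (\<lambda>t. cinner (G t v) v)" by (auto simp: has_bochner_integral_iff)
  thus "integrable (lebesgue_on S) (\<lambda>t. expect (G t) v)" unfolding expect_def by (rule integrable_Re)
  show "(LINT t|lebesgue_on S. expect (G t) v) = expect A v"
    unfolding expect_def using i hb by (simp add: has_bochner_integral_iff)
qed

text \<open>Makes the inner averages of the remainder positive, so that the existence criterion for
  positive families applies to the outer integral as well.\<close>

lemma has_weak_integral_positive: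
  assumes A: "has_weak_integral G A S" and S: "S \<in> sets lebesgue" and G: "\<And>t. t \<in> S \<Longrightarrow> G t \<in> positive_ops"
  shows "A \<in> positive_ops"
proof -
  have hb: "has_bochner_integral (lebesgue_on S) (\<lambda>t. cinner (G t x) y) (cinner (A x) y)" for x y
    using A by (simp add: has_weak_integral_def)
  have sa: "self_adjoint (G t)" if "t \<in> S" for t using G[OF that] by (rule positive_ops_self_adjoint)
  have "cinner (A x) y = cinner x (A y)" for x y
  proof -
    have "has_bochner_integral (lebesgue_on S) (\<lambda>t. cnj (cinner (G t y) x)) (cnj (cinner (A y) x))"
      by (rule has_bochner_integral_bounded_linear[OF bounded_linear_cnj hb])
    moreover have "cnj (cinner (G t y) x) = cinner (G t x) y" if "t \<in> S" for t
      using sa[OF that] cinner_commute[of x "G t y"] by (simp add: self_adjoint_def)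
    ultimately have "has_bochner_integral (lebesgue_on S) (\<lambda>t. cinner (G t x) y) (cnj (cinner (A y) x))"
      using S by (subst (asm) has_bochner_integral_cong[where g = "\<lambda>t. cinner (G t x) y"]) auto
    hence "cinner (A x) y = cnj (cinner (A y) x)" using hb has_bochner_integral_eq by blast
    thus ?thesis using cinner_commute[of x "A y"] by simp
  qed
  moreover have "0 \<le> expect A v" for v
  proof -
    have "0 \<le> (LINT t|lebesgue_on S. expect (G t) v)"
      using S G by (intro integral_nonneg_AE AE_I2) (auto simp: positive_ops_iff)
    thus ?thesis using has_weak_integral_expect(2)[OF A] by simp
  qed
  ultimately show ?thesis using A by (auto simp: positive_ops_iff self_adjoint_def has_weak_integral_def)
qed

text \<open>Polarization makes every matrix element integrable. The integrals form a bounded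
  sesquilinear form \<open>b\<close>, which Riesz representation turns into an operator.\<close>

lemma weakly_integrable_positiveI:
  fixes G :: "real \<Rightarrow> 'h::complex_hilbert_space \<Rightarrow>\<^sub>L 'h"
  assumes S: "S \<in> sets lebesgue" and G: "\<And>t. t \<in> S \<Longrightarrow> G t \<in> positive_ops"
    and int: "\<And>v. integrable (lebesgue_on S) (\<lambda>t. expect (G t) v)"
    and bound: "\<And>v. (LINT t|lebesgue_on S. expect (G t) v) \<le> C * (norm v)\<^sup>2"
  shows "weakly_integrable S G"
proof -
  let ?N = "lebesgue_on S"
  have sa: "self_adjoint (G t)" if "t \<in> S" for t using G[OF that] by (rule positive_ops_self_adjoint)
  have bo: "G t \<in> bounded_ops" if "t \<in> S" for t using sa[OF that] by (simp add: self_adjoint_def)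
  define e where "e v = (LINT t|?N. expect (G t) v)" for v
  have e: "0 \<le> e v" "e v \<le> C * (norm v)\<^sup>2" for v
    unfolding e_def using S G by (auto intro!: integral_nonneg_AE AE_I2 bound simp: positive_ops_iff)
  define b where "b x y = (LINT t|?N. cinner (G t x) y)" for x y
  have hb: "has_bochner_integral ?N (\<lambda>t. cinner (G t x) y)
    ((of_real (e (x + y)) - of_real (e (x - y)) + \<i> * of_real (e (x + scaleC \<i> y)) - \<i> * of_real (e (x - scaleC \<i> y))) / 4)" for x y
  proof -
    have "has_bochner_integral ?N (\<lambda>t. expect (G t) v) (e v)" for v
      using int by (simp add: e_def has_bochner_integral_iff)
    hence h: "has_bochner_integral ?N (\<lambda>t. complex_of_real (expect (G t) v)) (of_real (e v))" for v
      by (rule has_bochner_integral_of_real)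
    have "has_bochner_integral ?N
      (\<lambda>t. (of_real (expect (G t) (x + y)) - of_real (expect (G t) (x - y))
        + \<i> * of_real (expect (G t) (x + scaleC \<i> y)) - \<i> * of_real (expect (G t) (x - scaleC \<i> y))) / 4)
      ((of_real (e (x + y)) - of_real (e (x - y)) + \<i> * of_real (e (x + scaleC \<i> y)) - \<i> * of_real (e (x - scaleC \<i> y))) / 4)"
      by (intro has_bochner_integral_divide_zero has_bochner_integral_diff has_bochner_integral_add
          has_bochner_integral_mult_right h)
    moreover have "(of_real (expect (G t) (x + y)) - of_real (expect (G t) (x - y))
        + \<i> * of_real (expect (G t) (x + scaleC \<i> y)) - \<i> * of_real (expect (G t) (x - scaleC \<i> y))) / 4
        = cinner (G t x) y" if "t \<in> S" for t
      using polarization[OF bo[OF that], of x y] by (simp add: self_adjoint_cinner_self[OF sa[OF that]] mult.commute[of _ 4])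
    ultimately show ?thesis
      using S by (subst (asm) has_bochner_integral_cong[where g = "\<lambda>t. cinner (G t x) y"]) auto
  qed
  have b_int: "integrable ?N (\<lambda>t. cinner (G t x) y)" for x y
    using hb by (auto simp: has_bochner_integral_iff)
  have b_eq: "b x y = (of_real (e (x + y)) - of_real (e (x - y)) + \<i> * of_real (e (x + scaleC \<i> y)) - \<i> * of_real (e (x - scaleC \<i> y))) / 4" for x y
    using hb by (auto simp: b_def has_bochner_integral_iff)
  have b_add: "b (x + x') y = b x y + b x' y" for x x' y
    unfolding b_def by (simp add: blinfun.bilinear_simps cinner_simps b_int)
  have b_scaleC: "b (scaleC c x) y = c * b x y" for c x y
  proof -
    have "b (scaleC c x) y = (LINT t|?N. c * cinner (G t x) y)"
      unfolding b_def using S by (intro Bochner_Integration.integral_cong) (auto simp: bounded_ops_scaleC[OF bo] cinner_simps)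
    thus ?thesis by (simp add: b_def)
  qed
  have b_cnj: "b x y = cnj (b y x)" for x y
  proof -
    have "cinner (G t x) y = cnj (cinner (G t y) x)" if "t \<in> S" for t
      using sa[OF that] cinner_commute[of x "G t y"] by (simp add: self_adjoint_def)
    hence "b x y = (LINT t|?N. cnj (cinner (G t y) x))"
      unfolding b_def using S by (intro Bochner_Integration.integral_cong) auto
    thus ?thesis by (simp add: b_def)
  qed
  \<comment> \<open>The four vectors in the polarization formula have norm at most 2, so each term
    is at most 4 C, and the sum is divided by 4. Homogeneity extends the bound to all
    vectors.\<close>
  have b_unit: "cmod (b x y) \<le> 4 * C" if xy: "norm x = 1" "norm y = 1" for x y
  proof -
    have C0: "0 \<le> C" using e[of x] xy by simp
    have "e z \<le> C * 4" if "norm z \<le> 2" for z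
    proof -
      have "(norm z)\<^sup>2 \<le> 2\<^sup>2" using that by (intro power_mono) auto
      hence "C * (norm z)\<^sup>2 \<le> C * 4" using C0 by (intro mult_left_mono) auto
      thus ?thesis using e(2)[of z] by linarith
    qed
    hence n: "cmod (of_real (e z)) \<le> C * 4" if "norm z \<le> 2" for z using that e(1) by simp
    have "norm (x + y) \<le> 2" "norm (x - y) \<le> 2" "norm (x + scaleC \<i> y) \<le> 2" "norm (x - scaleC \<i> y) \<le> 2"
      using norm_triangle_ineq[of x y] norm_triangle_ineq4[of x y] norm_triangle_ineq[of x "scaleC \<i> y"]
        norm_triangle_ineq4[of x "scaleC \<i> y"] xy by (auto simp: norm_scaleC)
    note n4 = this[THEN n]
    have "cmod (of_real (e (x + y)) - of_real (e (x - y)) + \<i> * of_real (e (x + scaleC \<i> y)) - \<i> * of_real (e (x - scaleC \<i> y)))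
      \<le> C * 4 + C * 4 + C * 4 + C * 4"
      using n4 by (intro norm_triangle_le norm_triangle_le_diff add_mono) (auto simp: norm_mult)
    thus ?thesis unfolding b_eq by (simp add: norm_divide)
  qed
  have b_bound: "cmod (b x y) \<le> 4 * C * norm x * norm y" for x y
  proof (cases "x = 0 \<or> y = 0")
    case True
    thus ?thesis using b_scaleC[of 0 0 y] b_scaleC[of 0 0 x] b_cnj[of x y] by auto
  next
    case False
    define x' where "x' = scaleC (of_real (1 / norm x)) x"
    define y' where "y' = scaleC (of_real (1 / norm y)) y"
    have n: "norm x' = 1" "norm y' = 1" using False by (auto simp: x'_def y'_def norm_scaleC norm_divide)
    have xy: "x = scaleC (of_real (norm x)) x'" "y = scaleC (of_real (norm y)) y'"
      using False by (simp_all add: x'_def y'_def scaleC_scaleC)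
    have "b x y = of_real (norm x) * b x' y" by (subst xy(1)) (rule b_scaleC)
    also have "b x' y = of_real (norm y) * b x' y'"
      by (subst b_cnj, subst xy(2), subst b_scaleC) (simp add: b_cnj[of x' y'])
    finally have "cmod (b x y) = norm x * norm y * cmod (b x' y')" by (simp add: norm_mult)
    also have "\<dots> \<le> norm x * norm y * (4 * C)" by (intro mult_left_mono b_unit n) auto
    finally show ?thesis by (simp add: mult_ac)
  qed
  have bl: "bounded_linear (\<lambda>x. b x y)" for y
  proof (rule bounded_linear_intro[of _ "4 * C * norm y"])
    show "b (r *\<^sub>R x) y = r *\<^sub>R b x y" for r x
      using b_scaleC[of "of_real r" x y] by (simp add: scaleC_of_real scaleR_conv_of_real)
  qed (use b_add b_bound in \<open>auto simp: mult_ac\<close>)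
  have "\<exists>u. \<forall>x. b x y = cinner x u" for y by (rule riesz[OF bl]) (rule b_scaleC)
  then obtain f where f: "\<And>x y. b x y = cinner x (f y)" by metis
  have f': "cinner (f x) y = b x y" for x y by (metis b_cnj f cinner_commute)
  have blf: "bounded_linear f"
  proof (rule bounded_linear_intro[of _ "4 * C"])
    show "f (x + y) = f x + f y" for x y by (rule cinner_ext) (simp add: cinner_simps f' b_add)
    show "f (r *\<^sub>R x) = r *\<^sub>R f x" for r x
      by (rule cinner_ext) (simp only: cinner_scaleR_left f' b_scaleC[of "of_real r", unfolded scaleC_of_real])
    show "norm (f x) \<le> norm x * (4 * C)" for x
    proof (cases "f x = 0")
      case True
      \<comment> \<open>The sign of \<open>C\<close> is read off from 0 \<le> e x \<le> C
        |x|^2.\<close>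
      have "0 \<le> C * (norm x)\<^sup>2" using e[of x] by linarith
      hence "0 \<le> norm x * (4 * C)" by (cases "x = 0") (auto simp: zero_le_mult_iff)
      thus ?thesis using True by simp
    next
      case False
      have "(norm (f x))\<^sup>2 = Re (b x (f x))" by (simp only: Re_cinner_self[symmetric] f')
      also have "\<dots> \<le> 4 * C * norm x * norm (f x)" using b_bound[of x "f x"] complex_Re_le_cmod[of "b x (f x)"] by linarith
      finally show ?thesis using False by (simp add: power2_eq_square mult_ac)
    qed
  qed
  have app: "blinfun_apply (Blinfun f) = f" by (rule bounded_linear_Blinfun_apply[OF blf])
  have "f (scaleC c x) = scaleC c (f x)" for c x
    by (rule cinner_ext) (simp add: cinner_simps f' b_scaleC)
  hence "Blinfun f \<in> bounded_ops" by (simp add: bounded_ops_def app)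
  hence "has_weak_integral G (Blinfun f) S"
    unfolding has_weak_integral_def app f' using b_int by (simp add: b_def has_bochner_integral_iff)
  thus ?thesis by (auto simp: weakly_integrable_def)
qed

lemma borel_measurable_expect:
  assumes "weakly_measurable S G"
  shows "(\<lambda>t. expect (G t) v) \<in> borel_measurable (lebesgue_on S)"
  using assms unfolding weakly_measurable_def expect_def borel_measurable_complex_iff by blast

lemma positive_ops_scaleR: "T \<in> positive_ops \<Longrightarrow> 0 \<le> r \<Longrightarrow> r *\<^sub>R T \<in> positive_ops"
  by (simp add: positive_ops_iff self_adjoint_scaleR expect_scaleR)

text \<open>Measurability of the remainder in t is a separate premise for its weak integrability: on
  a non-separable space, functions of a weakly measurable operator family can fail to be weakly
  measurable.\<close>

theorem theorem3p2:
  fixes p :: real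
    and F :: "real \<Rightarrow> 'h::complex_hilbert_space \<Rightarrow>\<^sub>L 'h"
    and \<eta> :: 'h
  assumes "p \<ge> 2"
    and "\<And>t. t > 0 \<Longrightarrow> F t \<in> positive_ops"
    and "weakly_measurable {0<..} F"
    and "weakly_integrable {0<..} (\<lambda>x. op_powr (F x) p)"
    and "norm \<eta> = 1"
  shows
    "(\<forall>x>0. weakly_integrable {0<..<x} F) \<and>
     integrable (lebesgue_on {0<..}) (\<lambda>x. expect (mean_op F x) \<eta> powr p) \<and>
     ((\<forall>x>0. weakly_measurable {0<..<x} (remainder_integrand p F \<eta> x)) \<longrightarrow>
       (\<forall>x>0. weakly_integrable {0<..<x} (remainder_integrand p F \<eta> x)) \<and>
       weakly_integrable {0<..} (\<lambda>x. mean_op (remainder_integrand p F \<eta> x) x)) \<and>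
     (LINT x|lebesgue_on {0<..}. expect (mean_op F x) \<eta> powr p)
       \<le> (p / (p - 1)) powr p * (LINT x|lebesgue_on {0<..}. expect (op_powr (F x) p) \<eta>)
         - (p / (p - 1)) powr (p - 2)
           * expect (weak_integral {0<..} (\<lambda>x. mean_op (remainder_integrand p F \<eta> x) x)) \<eta>"
proof -
  note p = assms(1) and F = assms(2) and Fm = assms(3) and wip = assms(4) and \<eta> = assms(5)
  let ?M = "lebesgue_on {0::real<..}"
  let ?I = "\<lambda>x::real. lebesgue_on {0<..<x}"
  have ip: "0 < 1 / p" "1 / p < 1" "0 < p" "0 < p - 1" "1 < p" using p by (auto simp: field_simps)
  \<comment> \<open>The conjugate exponent; it is both the average of the weight x^(1/p) t^(-1/p)
    over (0, x) and the factor from the exchange of integrals.\<close>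
  define q where "q = p / (p - 1)"
  have q: "1 \<le> q" "0 < q" and q1: "1 / (1 - 1 / p) = q" using ip by (auto simp: q_def field_simps)

  \<comment> \<open>Expectations of \<open>F\<close> and of its p-th power on bounded
    intervals\<close>
  define B where "B = weak_integral {0<..} (\<lambda>x. op_powr (F x) p)"
  define g where "g v t = expect (op_powr (F t) p) v" for v t
  have g_pos: "0 \<le> g v t" if "0 < t" for v t
    using op_powr_positive[OF F[OF that] p] by (simp add: g_def positive_ops_iff)
  have g_int: "integrable ?M (g v)" and g_val: "(LINT t|?M. g v t) = expect B v" for v
    unfolding g_def[abs_def] B_def using has_weak_integral_expect[OF has_weak_integral_weak_integral[OF wip]] by auto
  have g_int_x: "integrable (?I x) (g v)" if "0 < x" for x v
    unfolding integrable_Ioo_iff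
    by (rule Bochner_Integration.integrable_bound[OF g_int[of v]])
       (use measurable_Ioo_indicator[OF measurable_Ioo] g_int[of v] in \<open>auto simp: indicator_def\<close>)
  have B_le: "expect B v \<le> norm B * (norm v)\<^sup>2" for v using abs_expect_le[of B v] by linarith
  have g_val_x: "(LINT t|?I x. g v t) \<le> norm B * (norm v)\<^sup>2" if x: "0 < x" for x v
  proof -
    have "(LINT t|?I x. g v t) \<le> (LINT t|?M. g v t)"
      unfolding integral_Ioo_eq using g_int_x[OF x, of v] g_int[of v] g_pos
      by (intro integral_mono) (auto simp: integrable_Ioo_iff indicator_def)
    thus ?thesis using g_val B_le[of v] by simp
  qed

  define f where "f v t = expect (F t) v" for v t
  have f_pos: "0 \<le> f v t" if "0 < t" for v t using F[OF that] by (simp add: f_def positive_ops_iff)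
  have f_meas: "f v \<in> borel_measurable (?I x)" for v x
    unfolding f_def[abs_def] by (intro measurable_Ioo borel_measurable_expect Fm)
  \<comment> \<open>On t > 0 the factor \<open>t powr 0\<close> is 1; in this form the power
    integral with exponent 0 covers the constant.\<close>
  have fb_int: "integrable (?I x) (\<lambda>t. (norm v)\<^sup>2 * t powr 0 + g v t)" if "0 < x" for x v
    using integral_powr_Ioo(1)[of 0 x] g_int_x[OF that] that by simp
  have f_le: "f v t \<le> (norm v)\<^sup>2 * t powr 0 + g v t" if "0 < t" for v t
    using expect_le_op_powr[OF F[OF that] p, of v] that by (simp add: f_def g_def)
  have f_int: "integrable (?I x) (f v)" if x: "0 < x" for x v
  proof (rule Bochner_Integration.integrable_bound[OF fb_int[OF x, of v] f_meas], rule AE_I2)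
    fix t assume "t \<in> space (?I x)"
    hence t: "0 < t" by simp
    show "norm (f v t) \<le> norm ((norm v)\<^sup>2 * t powr 0 + g v t)"
      unfolding real_norm_def using f_le[OF t, of v] f_pos[OF t, of v] by linarith
  qed
  have f_val: "(LINT t|?I x. f v t) \<le> (x + norm B) * (norm v)\<^sup>2" if x: "0 < x" for x v
  proof -
    have "(LINT t|?I x. f v t) \<le> (LINT t|?I x. (norm v)\<^sup>2 * t powr 0 + g v t)"
      using f_int[OF x] fb_int[OF x] f_le by (intro integral_mono) auto
    also have "\<dots> = (norm v)\<^sup>2 * x + (LINT t|?I x. g v t)"
      using integral_powr_Ioo[of 0 x] g_int_x[OF x] x by simp
    finally show ?thesis using g_val_x[OF x, of v] by (simp add: algebra_simps)
  qed
  have wiF: "weakly_integrable {0<..<x} F" if x: "0 < x" for x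
    by (rule weakly_integrable_positiveI[where C = "x + norm B"])
       (use F f_int[OF x] f_val[OF x] in \<open>auto simp: f_def[abs_def]\<close>)

  have mean_eq: "expect (mean_op G x) v = 1 / x * (LINT t|?I x. expect (G t) v)"
    if "weakly_integrable {0<..<x} G" for G :: "real \<Rightarrow> 'h \<Rightarrow>\<^sub>L 'h" and x v
    using has_weak_integral_expect(2)[OF has_weak_integral_weak_integral[OF that], of v]
    by (simp add: mean_op_def expect_scaleR)

  \<comment> \<open>The mean \<open>m\<close>, its continuity and the parameter
    \<open>c\<close>\<close>
  define m where "m x = expect (mean_op F x) \<eta>" for x
  have m_eq: "m x = 1 / x * (LINT t|?I x. f \<eta> t)" if "0 < x" for x
    unfolding m_def mean_eq[OF wiF[OF that]] f_def ..
  have f_nn: "0 \<le> (LINT t|?I x. f \<eta> t)" for x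
    by (intro integral_nonneg_AE AE_I2) (simp add: f_pos)
  have m_pos: "0 \<le> m x" if "0 < x" for x using f_nn[of x] that by (simp add: m_eq)
  have ev_pos: "\<forall>\<^sub>F x in nhds x0. 0 < x" if "0 < x0" for x0 :: real
    using eventually_nhds_in_open[of "{0<..}" x0] that by simp
  have m_cont: "isCont m x0" if x0: "0 < x0" for x0
  proof -
    have "isCont (\<lambda>x. LINT t|?I x. f \<eta> t) x0"
      by (rule isCont_integral_Ioo[OF x0, where h = "f \<eta>"])
         (use f_meas f_int[of "2 * x0"] x0 f_pos in auto)
    hence "isCont (\<lambda>x. 1 / x * (LINT t|?I x. f \<eta> t)) x0" using x0 by (intro continuous_intros) auto
    moreover have "\<forall>\<^sub>F x in nhds x0. m x = 1 / x * (LINT t|?I x. f \<eta> t)"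
      using ev_pos[OF x0] by eventually_elim (rule m_eq)
    note isCont_cong[OF this]
    ultimately show ?thesis by (rule iffD2[rotated])
  qed

  define c where "c x = (p - 1) / p * m x" for x
  have c_pos: "0 \<le> c x" if "0 < x" for x using m_pos[OF that] p by (simp add: c_def)
  have c_cont: "isCont c x0" if "0 < x0" for x0
    unfolding c_def[abs_def] by (intro continuous_intros m_cont[OF that])
  have m_c: "m x = q * c x" for x using ip by (simp add: c_def q_def)

  \<comment> \<open>Weighted averages of the expectations of F^p\<close>
  define U where "U v x = x powr (1 / p - 2) * (LINT t|?I x. t powr (1 - 1 / p) * g v t)" for v x
  have U: "\<And>x. 0 < x \<Longrightarrow> integrable (?I x) (\<lambda>t. t powr (1 - 1 / p) * g v t)"
      "integrable ?M (U v)" "(LINT x|?M. U v x) = q * (LINT t|?M. g v t)" for v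
    unfolding U_def[abs_def] q_def by (rule weighted_average_integral[OF ip(5) g_int[of v] g_pos], assumption+)+
  have xU: "x powr (1 / p - 1) * (LINT t|?I x. t powr (1 - 1 / p) * g v t) = x * U v x" if x: "0 < x" for v x
  proof -
    have "x powr (1 / p - 1) = x powr 1 * x powr (1 / p - 2)" by (subst powr_add[symmetric]) simp
    thus ?thesis using x by (simp add: U_def)
  qed
  have wpow: "integrable (?I x) (\<lambda>t. t powr (- (1 / p)))"
      "x powr (1 / p) * (LINT t|?I x. t powr (- (1 / p))) = x * q" if x: "0 < x" for x
  proof -
    show "integrable (?I x) (\<lambda>t. t powr (- (1 / p)))" using ip x by (intro integral_powr_Ioo) auto
    have "(LINT t|?I x. t powr (- (1 / p))) = x powr (1 - 1 / p) * q"
      using integral_powr_Ioo(2)[of "- (1 / p)" x] ip x q1 by (simp add: divide_inverse)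
    moreover have "x powr (1 / p) * x powr (1 - 1 / p) = x" using x by (simp add: powr_add[symmetric])
    ultimately show "x powr (1 / p) * (LINT t|?I x. t powr (- (1 / p))) = x * q"
      by (simp add: mult.assoc[symmetric])
  qed

  \<comment> \<open>The pointwise estimate of the remainder \<open>R\<close>\<close>
  let ?s = "\<lambda>x t::real. x powr (- (1 / p)) * t powr (1 / p)"
  let ?w = "\<lambda>x t::real. x powr (1 / p) * t powr (- (1 / p))"
  define Q where "Q x t = op_powr (op_abs (?s x t *\<^sub>R F t - c x *\<^sub>R id_blinfun)) p" for x t
  define R where "R = remainder_integrand p F \<eta>"
  have R_eq: "R x t = ?w x t *\<^sub>R Q x t" for x t
    by (simp add: R_def remainder_integrand_def Q_def c_def m_def)
  have Q_pos: "Q x t \<in> positive_ops" if "0 < t" for x t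
    unfolding Q_def by (rule op_powr_op_abs_affine_positive[OF F[OF that] p])
  have R_pos: "R x t \<in> positive_ops" if "0 < t" for x t
    unfolding R_eq by (intro positive_ops_scaleR Q_pos that) simp
  have R_nn: "0 \<le> expect (R x t) v" if "0 < t" for x t v
    using R_pos[OF that] by (simp add: positive_ops_iff)
  \<comment> \<open>The weight is matched to the scaling: the first identity leaves
    \<open>F t\<close> unweighted in the linear term, so that its average is m(x); the second
    produces x times the kernel of \<open>U\<close>.\<close>
  have ws: "?w x t * ?s x t = 1" "?w x t * ?s x t powr p = x powr (1 / p - 1) * t powr (1 - 1 / p)"
    if "0 < x" "0 < t" for x t
  proof -
    have "?w x t * ?s x t = (x powr (1 / p) * x powr (- (1 / p))) * (t powr (- (1 / p)) * t powr (1 / p))"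
      by (simp only: mult_ac)
    thus "?w x t * ?s x t = 1" using that by (simp add: powr_add[symmetric])
    have "?s x t powr p = x powr (- 1) * t powr 1"
      using that p by (simp add: powr_mult powr_powr)
    hence "?w x t * ?s x t powr p = (x powr (1 / p) * x powr (- 1)) * (t powr (- (1 / p)) * t powr 1)"
      by (simp only: mult_ac)
    thus "?w x t * ?s x t powr p = x powr (1 / p - 1) * t powr (1 - 1 / p)"
      by (simp only: powr_add[symmetric]) (simp add: add.commute)
  qed

  \<comment> \<open>The sharp bound multiplied by the weight; the constant terms - c^p + p c c^(p-1)
    have merged into (p - 1) c^p.\<close>
  define H where "H x t = x powr (1 / p - 1) * (t powr (1 - 1 / p) * g \<eta> t) - p * c x powr (p - 1) * f \<eta> t
    + (p - 1) * c x powr p * (x powr (1 / p) * t powr (- (1 / p)))" for x t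
  have c_powr: "c x * c x powr (p - 1) = c x powr p" if "0 < x" for x
    using c_pos[OF that] by (cases "c x = 0") (auto simp: powr_diff)
  have R_le: "expect (R x t) \<eta> \<le> H x t" if x: "0 < x" and t: "0 < t" for x t
  proof -
    have "expect (Q x t) \<eta> \<le> ?s x t powr p * g \<eta> t - c x powr p - p * c x powr (p - 1) * (?s x t * f \<eta> t - c x)"
      using expect_op_powr_op_abs_affine_le[OF F[OF t] p, of "?s x t" "c x" \<eta>] c_pos[OF x]
      by (simp add: Q_def g_def f_def \<eta>)
    hence "expect (R x t) \<eta> \<le> ?w x t * (?s x t powr p * g \<eta> t - c x powr p - p * c x powr (p - 1) * (?s x t * f \<eta> t - c x))"
      unfolding R_eq expect_scaleR by (intro mult_left_mono) auto
    also have "\<dots> = (?w x t * ?s x t powr p) * g \<eta> t - p * c x powr (p - 1) * ((?w x t * ?s x t) * f \<eta> t)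
        + ?w x t * (p * (c x * c x powr (p - 1)) - c x powr p)"
      by (simp add: algebra_simps)
    also have "\<dots> = H x t"
      unfolding ws[OF x t] c_powr[OF x] H_def by (simp add: algebra_simps)
    finally show ?thesis .
  qed
  have H_int: "integrable (?I x) (H x)" if x: "0 < x" for x
    unfolding H_def[abs_def] using U(1)[OF x, of \<eta>] f_int[OF x] wpow(1)[OF x] by simp
  have H_val: "(LINT t|?I x. H x t) = x * (U \<eta> x - q * c x powr p)" if x: "0 < x" for x
  proof -
    have "(LINT t|?I x. H x t) = x powr (1 / p - 1) * (LINT t|?I x. t powr (1 - 1 / p) * g \<eta> t)
        - p * c x powr (p - 1) * (LINT t|?I x. f \<eta> t)
        + (p - 1) * c x powr p * (x powr (1 / p) * (LINT t|?I x. t powr (- (1 / p))))"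
      unfolding H_def using U(1)[OF x, of \<eta>] f_int[OF x] wpow(1)[OF x] by simp
    also have "\<dots> = x * U \<eta> x - p * c x powr (p - 1) * (x * m x) + (p - 1) * c x powr p * (x * q)"
      unfolding xU[OF x] wpow(2)[OF x] using x by (simp add: m_eq)
    \<comment> \<open>Substituting m = q c leaves q (p c^p - (p - 1) c^p) = q c^p.\<close>
    also have "\<dots> = x * (U \<eta> x - q * (p * (c x * c x powr (p - 1)) - (p - 1) * c x powr p))"
      unfolding m_c by (simp add: algebra_simps)
    finally show ?thesis unfolding c_powr[OF x] by (simp add: algebra_simps)
  qed
  \<comment> \<open>Only \<open>H\<close> has to be integrable here: 0 \<le> R \<le> H pointwise
    makes its integral nonnegative, whether or not \<open>R x\<close> has a weak integral.\<close>
  have cU: "q * c x powr p \<le> U \<eta> x" if x: "0 < x" for x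
  proof -
    have "0 \<le> (LINT t|?I x. H x t)"
      using R_nn R_le[OF x] by (intro integral_nonneg_AE AE_I2) (force intro: order_trans)
    thus ?thesis unfolding H_val[OF x] using x by (simp add: zero_le_mult_iff)
  qed
  define r where "r x = expect (mean_op (R x) x) \<eta>" for x
  have r: "0 \<le> r x" "r x \<le> U \<eta> x - q * c x powr p" if x: "0 < x" for x
  proof -
    have "0 \<le> r x \<and> r x \<le> U \<eta> x - q * c x powr p"
    proof (cases "weakly_integrable {0<..<x} (R x)")
      case True
      have i: "integrable (?I x) (\<lambda>t. expect (R x t) \<eta>)"
        by (rule has_weak_integral_expect(1)[OF has_weak_integral_weak_integral[OF True]])
      have "(LINT t|?I x. expect (R x t) \<eta>) \<le> (LINT t|?I x. H x t)"
        using i H_int[OF x] R_le[OF x] by (intro integral_mono) auto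
      moreover have "0 \<le> (LINT t|?I x. expect (R x t) \<eta>)"
        using R_nn by (intro integral_nonneg_AE AE_I2) auto
      ultimately show ?thesis unfolding r_def mean_eq[OF True] H_val[OF x] using x by (simp add: field_simps)
    next
      case False
      hence "r x = 0" by (simp add: r_def mean_op_def weak_integral_def expect_scaleR expect_0)
      thus ?thesis using cU[OF x] by simp
    qed
    thus "0 \<le> r x" "r x \<le> U \<eta> x - q * c x powr p" by auto
  qed

  \<comment> \<open>Integrability of the left-hand side\<close>
  have c_meas: "(\<lambda>x. c x powr p) \<in> borel_measurable ?M"
  proof -
    have "continuous_on {0<..} c" using c_cont by (intro continuous_at_imp_continuous_on) auto
    hence "c \<in> borel_measurable ?M" by (rule continuous_imp_measurable_on_sets_lebesgue) auto
    thus ?thesis by measurable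
  qed
  have c_int: "integrable ?M (\<lambda>x. c x powr p)"
  proof (rule Bochner_Integration.integrable_bound[OF U(2)[of \<eta>] c_meas], rule AE_I2)
    fix x assume "x \<in> space ?M"
    hence x: "0 < x" by simp
    have "1 * c x powr p \<le> q * c x powr p" using q by (intro mult_right_mono) auto
    thus "norm (c x powr p) \<le> norm (U \<eta> x)" using cU[OF x] by simp
  qed
  define J where "J = (LINT x|?M. c x powr p)"
  have J: "0 \<le> J" unfolding J_def by (intro integral_nonneg_AE AE_I2) simp
  have m_powr: "m x powr p = q powr p * c x powr p" if "0 < x" for x
    unfolding m_c using q c_pos[OF that] by (simp add: powr_mult)
  have m_int: "integrable ?M (\<lambda>x. m x powr p)"
    by (subst Bochner_Integration.integrable_cong[OF refl m_powr]) (use c_int in auto)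
  have m_val: "(LINT x|?M. m x powr p) = q powr p * J"
    by (subst Bochner_Integration.integral_cong[OF refl m_powr]) (auto simp: J_def)

  \<comment> \<open>Existence of the weak integrals of the remainder\<close>
  have powr_ratio: "x powr (1 / p - 1) * t powr (1 - 1 / p) \<le> 1" if "0 < t" "t < x" for x t
  proof -
    have "x powr (1 / p - 1) * t powr (1 - 1 / p) \<le> x powr (1 / p - 1) * x powr (1 - 1 / p)"
      using that ip by (intro mult_left_mono powr_mono2) auto
    also have "\<dots> = 1" using that by (simp add: powr_add[symmetric])
    finally show ?thesis .
  qed
  have R_crude: "expect (R x t) v \<le> x powr (1 / p - 1) * (t powr (1 - 1 / p) * g v t)
      + c x powr p * (norm v)\<^sup>2 * (x powr (1 / p) * t powr (- (1 / p)))"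
    if x: "0 < x" and t: "0 < t" for x t v
  proof -
    have "expect (Q x t) v \<le> ?s x t powr p * g v t + c x powr p * (norm v)\<^sup>2"
      using expect_op_powr_op_abs_affine_crude[OF F[OF t] p, of "?s x t" "c x" v] c_pos[OF x]
      by (simp add: Q_def g_def)
    hence "expect (R x t) v \<le> ?w x t * (?s x t powr p * g v t + c x powr p * (norm v)\<^sup>2)"
      unfolding R_eq expect_scaleR by (intro mult_left_mono) auto
    also have "\<dots> = (?w x t * ?s x t powr p) * g v t + c x powr p * (norm v)\<^sup>2 * ?w x t"
      by (simp add: algebra_simps)
    finally show ?thesis unfolding ws[OF x t] by (simp add: mult.assoc)
  qed
  \<comment> \<open>Dropping the kernel, which is at most 1 for t < x, bounds the inner integral
    through B and gives a majorant that can be chosen uniformly for x near x0. The version with the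
    kernel is kept for the outer integral, where \<open>U\<close> must appear.\<close>
  have R_crude': "expect (R x t) v \<le> g v t + c x powr p * (norm v)\<^sup>2 * (x powr (1 / p) * t powr (- (1 / p)))"
    if "0 < x" "0 < t" "t < x" for x t v
    using R_crude[OF that(1,2), of v] mult_right_mono[OF powr_ratio[OF that(2,3)] g_pos[OF that(2), of v]]
    by (simp add: mult.assoc)

  have weak: "(\<forall>x>0. weakly_integrable {0<..<x} (R x)) \<and> weakly_integrable {0<..} (\<lambda>x. mean_op (R x) x)"
    if wm: "\<forall>x>0. weakly_measurable {0<..<x} (R x)"
  proof -
    have R_meas: "(\<lambda>t. expect (R x t) v) \<in> borel_measurable (?I x)" if "0 < x" for x v
      using wm that by (intro borel_measurable_expect) auto
    let ?b = "\<lambda>x v t. g v t + c x powr p * (norm v)\<^sup>2 * (x powr (1 / p) * t powr (- (1 / p)))"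
    have b_int: "integrable (?I x) (?b x v)" if x: "0 < x" for x v
      using g_int_x[OF x] wpow(1)[OF x] by simp
    have R_int: "integrable (?I x) (\<lambda>t. expect (R x t) v)" if x: "0 < x" for x v
    proof (rule Bochner_Integration.integrable_bound[OF b_int[OF x, of v] R_meas[OF x]], rule AE_I2)
      fix t assume "t \<in> space (?I x)"
      hence t: "0 < t" "t < x" by auto
      show "norm (expect (R x t) v) \<le> norm (?b x v t)"
        using R_nn[OF t(1), of x v] R_crude'[OF x t, of v] by simp
    qed
    have wiR: "weakly_integrable {0<..<x} (R x)" if x: "0 < x" for x
    proof (rule weakly_integrable_positiveI[where C = "norm B + c x powr p * (x * q)"])
      fix v
      have "(LINT t|?I x. expect (R x t) v) \<le> (LINT t|?I x. ?b x v t)"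
        using R_int[OF x] b_int[OF x] R_crude'[OF x] by (intro integral_mono) auto
      also have "\<dots> = (LINT t|?I x. g v t) + c x powr p * (norm v)\<^sup>2 * (x powr (1 / p) * (LINT t|?I x. t powr (- (1 / p))))"
        using g_int_x[OF x] wpow(1)[OF x] by simp
      also have "\<dots> \<le> (norm B + c x powr p * (x * q)) * (norm v)\<^sup>2"
        unfolding wpow(2)[OF x] using g_val_x[OF x, of v] by (simp add: algebra_simps)
      finally show "(LINT t|?I x. expect (R x t) v) \<le> (norm B + c x powr p * (x * q)) * (norm v)\<^sup>2" .
    qed (use R_pos R_int[OF x] in auto)
    have mean_R: "expect (mean_op (R x) x) v = 1 / x * (LINT t|?I x. expect (R x t) v)" if "0 < x" for x v
      by (rule mean_eq[OF wiR[OF that]])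
    have mean_nn: "0 \<le> expect (mean_op (R x) x) v" if x: "0 < x" for x v
      unfolding mean_R[OF x] using x R_nn by (intro mult_nonneg_nonneg integral_nonneg_AE AE_I2) auto
    have mean_le: "expect (mean_op (R x) x) v \<le> U v x + q * (norm v)\<^sup>2 * c x powr p" if x: "0 < x" for x v
    proof -
      have "(LINT t|?I x. expect (R x t) v) \<le> (LINT t|?I x. x powr (1 / p - 1) * (t powr (1 - 1 / p) * g v t)
          + c x powr p * (norm v)\<^sup>2 * (x powr (1 / p) * t powr (- (1 / p))))"
        using R_int[OF x] R_crude[OF x] U(1)[OF x, of v] wpow(1)[OF x] by (intro integral_mono) auto
      also have "\<dots> = x powr (1 / p - 1) * (LINT t|?I x. t powr (1 - 1 / p) * g v t)
          + c x powr p * (norm v)\<^sup>2 * (x powr (1 / p) * (LINT t|?I x. t powr (- (1 / p))))"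
        using U(1)[OF x, of v] wpow(1)[OF x] by simp
      also have "\<dots> = x * (U v x + q * (norm v)\<^sup>2 * c x powr p)"
        unfolding xU[OF x] wpow(2)[OF x] by (simp add: algebra_simps)
      finally show ?thesis unfolding mean_R[OF x] using x by (simp add: field_simps)
    qed
    have mean_cont: "isCont (\<lambda>x. 1 / x * (LINT t|?I x. expect (R x t) v)) x0" if x0: "0 < x0" for x0 v
    proof -
      \<comment> \<open>Bounds \<open>c\<close> on (x0/2, 2 x0): the integral of f over (0, x) is
        largest for the longest interval, and 1 / x is at most 2 / x0.\<close>
      define L where "L = (p - 1) / p * (2 / x0 * (LINT t|?I (2 * x0). f \<eta> t))"
      have cL: "c x \<le> L" if x: "x0 / 2 < x" "x < 2 * x0" for x
      proof -
        have "0 < x" using x x0 by linarith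
        have "(LINT t|?I x. f \<eta> t) \<le> (LINT t|?I (2 * x0). f \<eta> t)"
          unfolding integral_Ioo_eq
          using f_int[OF \<open>0 < x\<close>, of \<eta>] f_int[of "2 * x0" \<eta>] x x0 f_pos
          by (intro integral_mono) (auto simp: integrable_Ioo_iff indicator_def)
        moreover have "1 / x \<le> 2 / x0" using x x0 \<open>0 < x\<close> by (simp add: field_simps)
        ultimately have "m x \<le> 2 / x0 * (LINT t|?I (2 * x0). f \<eta> t)"
          unfolding m_eq[OF \<open>0 < x\<close>] using x0 f_nn[of x] \<open>0 < x\<close> by (intro mult_mono) auto
        thus ?thesis unfolding c_def L_def using ip by (intro mult_left_mono) auto
      qed
      have "isCont (\<lambda>x. LINT t|?I x. expect (R x t) v) x0"
      proof (rule isCont_integral_Ioo[OF x0,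
            where h = "\<lambda>t. g v t + L powr p * (norm v)\<^sup>2 * ((2 * x0) powr (1 / p) * t powr (- (1 / p)))"])
        show "(\<lambda>t. expect (R x t) v) \<in> borel_measurable (?I x)" if "x0 / 2 < x" "x < 2 * x0" for x
          using that x0 by (intro R_meas) linarith
        show "integrable (?I (2 * x0)) (\<lambda>t. g v t + L powr p * (norm v)\<^sup>2 * ((2 * x0) powr (1 / p) * t powr (- (1 / p))))"
          using g_int_x[of "2 * x0"] wpow(1)[of "2 * x0"] x0 by simp
        show "\<bar>expect (R x t) v\<bar> \<le> g v t + L powr p * (norm v)\<^sup>2 * ((2 * x0) powr (1 / p) * t powr (- (1 / p)))"
          if x: "x0 / 2 < x" "x < 2 * x0" and t: "0 < t" "t < x" for x t
        proof -
          have "0 < x" using x x0 by linarith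
          have "c x powr p * (norm v)\<^sup>2 * (x powr (1 / p) * t powr (- (1 / p)))
              \<le> L powr p * (norm v)\<^sup>2 * ((2 * x0) powr (1 / p) * t powr (- (1 / p)))"
            using cL[OF x] c_pos[OF \<open>0 < x\<close>] \<open>0 < x\<close> x ip
            by (intro mult_mono mult_right_mono powr_mono2) auto
          thus ?thesis using R_nn[OF t(1), of x v] R_crude'[OF \<open>0 < x\<close> t, of v] by simp
        qed
        show "isCont (\<lambda>x. expect (R x t) v) x0" if t: "0 < t" "t < x0" for t
        proof -
          have "isCont (\<lambda>x. expect (Q x t) v) x0"
            unfolding Q_def continuous_at using c_cont[OF x0] x0
            by (intro tendsto_expect_op_powr_op_abs_affine[OF F[OF t(1)] p])
               (auto simp: continuous_at intro!: tendsto_intros)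
          thus ?thesis unfolding R_eq expect_scaleR using x0 by (intro continuous_intros) auto
        qed
      qed
      thus ?thesis using x0 by (intro continuous_intros) auto
    qed
    \<comment> \<open>The continuity just shown supplies the measurability in x, without joint
      measurability in (x, t).\<close>
    have mean_meas: "(\<lambda>x. expect (mean_op (R x) x) v) \<in> borel_measurable ?M" for v
    proof -
      have "continuous_on {0<..} (\<lambda>x. 1 / x * (LINT t|?I x. expect (R x t) v))"
        using mean_cont by (intro continuous_at_imp_continuous_on) auto
      hence "(\<lambda>x. 1 / x * (LINT t|?I x. expect (R x t) v)) \<in> borel_measurable ?M"
        by (rule continuous_imp_measurable_on_sets_lebesgue) auto
      thus ?thesis by (subst measurable_cong[OF mean_R]) auto
    qed
    have d_int: "integrable ?M (\<lambda>x. U v x + q * (norm v)\<^sup>2 * c x powr p)" for v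
      using U(2)[of v] c_int by simp
    have mean_int: "integrable ?M (\<lambda>x. expect (mean_op (R x) x) v)" for v
    proof (rule Bochner_Integration.integrable_bound[OF d_int[of v] mean_meas], rule AE_I2)
      fix x assume "x \<in> space ?M"
      hence x: "0 < x" by simp
      show "norm (expect (mean_op (R x) x) v) \<le> norm (U v x + q * (norm v)\<^sup>2 * c x powr p)"
        using mean_nn[OF x, of v] mean_le[OF x, of v] by simp
    qed
    have "weakly_integrable {0<..} (\<lambda>x. mean_op (R x) x)"
    \<comment> \<open>The first summand of \<open>C\<close> comes from integrating \<open>U\<close>,
      whose integral is q <B v, v>, and the second from the term with c^p.\<close>
    proof (rule weakly_integrable_positiveI[where C = "q * norm B + q * J"])
      fix v
      have "(LINT x|?M. expect (mean_op (R x) x) v) \<le> (LINT x|?M. U v x + q * (norm v)\<^sup>2 * c x powr p)"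
        using mean_int d_int mean_le by (intro integral_mono) auto
      also have "\<dots> = q * expect B v + q * (norm v)\<^sup>2 * J"
        using U(2)[of v] c_int by (simp add: U(3) g_val J_def)
      also have "\<dots> \<le> (q * norm B + q * J) * (norm v)\<^sup>2"
        using mult_left_mono[OF B_le[of v], of q] q by (simp add: algebra_simps)
      finally show "(LINT x|?M. expect (mean_op (R x) x) v) \<le> (q * norm B + q * J) * (norm v)\<^sup>2" .
    next
      fix x :: real assume "x \<in> {0<..}"
      hence x: "0 < x" by simp
      have "weak_integral {0<..<x} (R x) \<in> positive_ops"
        by (rule has_weak_integral_positive[OF has_weak_integral_weak_integral[OF wiR[OF x]]]) (use R_pos in auto)
      thus "mean_op (R x) x \<in> positive_ops" unfolding mean_op_def using x by (intro positive_ops_scaleR) auto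
    qed (use mean_int in auto)
    thus ?thesis using wiR by blast
  qed

  \<comment> \<open>Integration over x and the final constants\<close>
  define E where "E = expect (weak_integral {0<..} (\<lambda>x. mean_op (R x) x)) \<eta>"
  have "0 \<le> E \<and> E \<le> q * expect B \<eta> - q * J"
  proof (cases "weakly_integrable {0<..} (\<lambda>x. mean_op (R x) x)")
    case True
    note hw = has_weak_integral_expect[OF has_weak_integral_weak_integral[OF True], of \<eta>, folded r_def]
    have E: "E = (LINT x|?M. r x)" using hw(2) by (simp add: E_def)
    have "(LINT x|?M. r x) \<le> (LINT x|?M. U \<eta> x - q * c x powr p)"
      using hw(1) U(2)[of \<eta>] c_int r by (intro integral_mono) auto
    also have "\<dots> = q * expect B \<eta> - q * J" using U(2)[of \<eta>] c_int by (simp add: U(3) g_val J_def)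
    finally have "E \<le> q * expect B \<eta> - q * J" unfolding E .
    moreover have "0 \<le> E" unfolding E using r by (intro integral_nonneg_AE AE_I2) auto
    ultimately show ?thesis by simp
  next
    case False
    have "(LINT x|?M. 0) \<le> (LINT x|?M. U \<eta> x - q * c x powr p)"
      using U(2)[of \<eta>] c_int cU by (intro integral_mono) auto
    also have "\<dots> = q * expect B \<eta> - q * J" using U(2)[of \<eta>] c_int by (simp add: U(3) g_val J_def)
    finally show ?thesis using False by (simp add: E_def weak_integral_def expect_0)
  qed
  hence E: "0 \<le> E" "E \<le> q * (expect B \<eta> - J)" by (auto simp: algebra_simps)
  have "q powr (p - 2) * E \<le> q powr (p - 1) * E" using q E(1) by (intro mult_right_mono powr_mono) auto
  \<comment> \<open>The factor q^(p-1) raises the q in front of J to q^p, and q^p J is the integral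
    of m^p.\<close>
  also have "\<dots> \<le> q powr (p - 1) * (q * (expect B \<eta> - J))" using E(2) by (intro mult_left_mono) auto
  also have "\<dots> = q powr p * (expect B \<eta> - J)"
    using q powr_add[of q "p - 1" 1] by simp
  finally have "q powr p * J \<le> q powr p * expect B \<eta> - q powr (p - 2) * E" by (simp add: algebra_simps)
  hence "(LINT x|?M. m x powr p) \<le> q powr p * (LINT x|?M. g \<eta> x) - q powr (p - 2) * E"
    unfolding m_val g_val .
  thus ?thesis using wiF m_int weak unfolding m_def E_def R_def q_def g_def by blast
qed

end
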